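(* Let $G$ be a connected abelian Lie group. Then the action of $\mathrm{Aut}(G)$ on $G$ has a dense orbit if and only if $G$ is not topologically isomorphic to the circle group.
   Context: $\mathrm{Aut}(G)$ is the group of all continuous automorphisms of the Lie group $G$. *)

theory Defs
  imports "HOL-Analysis.Analysis" "HOL-Algebra.Bij" "HOL-Algebra.Group_Action"
begin

section \<open>Smooth manifolds\<close>

text \<open>
  The model space of a manifold is a linear subspace \<open>V\<close> of a Euclidean space, so that every
  finite dimension is covered, including 0 (a type of class \<^class>\<open>euclidean_space\<close> has
  positive dimension). For \<open>U\<close> open in \<open>V\<close>, \<open>C_k k V U f\<close> says that \<open>f\<close> is \<open>k\<close> times
  continuously differentiable on \<open>U\<close>: at points of \<open>U\<close> the derivative within \<open>U\<close> is uniquely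
  determined on \<open>V\<close>, and its values outside \<open>V\<close> are never used.
\<close>

primrec C_k :: "nat \<Rightarrow> 'e::real_normed_vector set \<Rightarrow> 'e set \<Rightarrow> ('e \<Rightarrow> 'f::real_normed_vector) \<Rightarrow> bool"
  where
    "C_k 0 V U f \<longleftrightarrow> continuous_on U f"
  | "C_k (Suc k) V U f \<longleftrightarrow>
       (\<exists>f'. (\<forall>x\<in>U. (f has_derivative f' x) (at x within U)) \<and>
             (\<forall>v\<in>V. C_k k V U (\<lambda>x. f' x v)))"

definition smooth_on :: "'e::real_normed_vector set \<Rightarrow> 'e set \<Rightarrow> ('e \<Rightarrow> 'f::real_normed_vector) \<Rightarrow> bool"
  where "smooth_on V U f \<longleftrightarrow> (\<forall>k. C_k k V U f)"

text \<open>A chart is a pair of its domain and its coordinate map, which is relevant only on the domain.\<close>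

type_synonym ('a, 'e) chart = "'a set \<times> ('a \<Rightarrow> 'e)"

definition is_chart :: "'a topology \<Rightarrow> 'e::euclidean_space set \<Rightarrow> ('a, 'e) chart \<Rightarrow> bool"
  where "is_chart X V = (\<lambda>(U, \<phi>).
     openin X U \<and> openin (top_of_set V) (\<phi> ` U) \<and>
     homeomorphic_map (subtopology X U) (top_of_set (\<phi> ` U)) \<phi>)"

definition smooth_compatible :: "'e::euclidean_space set \<Rightarrow> ('a, 'e) chart \<Rightarrow> ('a, 'e) chart \<Rightarrow> bool"
  where "smooth_compatible V = (\<lambda>(U, \<phi>) (U', \<phi>').
     smooth_on V (\<phi> ` (U \<inter> U')) (\<lambda>p. \<phi>' (inv_into U \<phi> p)))"

text \<open>The atlas need not be maximal: any atlas determines a smooth structure.\<close>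

locale smooth_manifold =
  fixes X :: "'a topology" and V :: "'e::euclidean_space set" and A :: "('a, 'e) chart set"
  assumes subspace_model: "subspace V"
    and Hausdorff: "Hausdorff_space X"
    and second_countable: "second_countable X"
    and charts: "\<And>c. c \<in> A \<Longrightarrow> is_chart X V c"
    and charts_cover: "(\<Union>c\<in>A. fst c) = topspace X"
    and charts_compatible: "\<And>c d. c \<in> A \<Longrightarrow> d \<in> A \<Longrightarrow> smooth_compatible V c d"

definition prod_atlas :: "('a, 'e) chart set \<Rightarrow> ('b, 'f) chart set \<Rightarrow> ('a \<times> 'b, 'e \<times> 'f) chart set"
  where "prod_atlas A B = {(U \<times> U', map_prod \<phi> \<phi>') | U \<phi> U' \<phi>'. (U, \<phi>) \<in> A \<and> (U', \<phi>') \<in> B}"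

text \<open>The model space of the target plays no role in the smoothness of a map.\<close>

definition smooth_map ::
  "'a topology \<Rightarrow> 'e::euclidean_space set \<Rightarrow> ('a, 'e) chart set \<Rightarrow>
   'b topology \<Rightarrow> ('b, 'f::euclidean_space) chart set \<Rightarrow> ('a \<Rightarrow> 'b) \<Rightarrow> bool"
  where "smooth_map X V A Y B f \<longleftrightarrow>
     continuous_map X Y f \<and>
     (\<forall>(U, \<phi>)\<in>A. \<forall>(W, \<psi>)\<in>B.
        smooth_on V (\<phi> ` {x \<in> U. f x \<in> W}) (\<lambda>p. \<psi> (f (inv_into U \<phi> p))))"

section \<open>Lie groups\<close>

locale lie_group = group G + smooth_manifold X V A
  for G :: "('a, 'b) monoid_scheme" (structure)
    and X :: "'a topology" and V :: "'e::euclidean_space set" and A :: "('a, 'e) chart set" +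
  assumes topspace_eq_carrier: "topspace X = carrier G"
    and smooth_mult:
      "smooth_map (prod_topology X X) (V \<times> V) (prod_atlas A A) X A (\<lambda>(x, y). x \<otimes> y)"
    and smooth_inv: "smooth_map X V A X A (\<lambda>x. inv x)"

text \<open>
  Continuity of the inverse automorphism is not demanded: for a connected Lie group it is
  automatic, by the open mapping theorem.
\<close>

definition continuous_Aut :: "('a, 'b) monoid_scheme \<Rightarrow> 'a topology \<Rightarrow> ('a \<Rightarrow> 'a) monoid"
  where "continuous_Aut G X =
     BijGroup (carrier G) \<lparr>carrier := {\<alpha> \<in> auto G. continuous_map X X \<alpha>}\<rparr>"

definition has_dense_orbit :: "'a topology \<Rightarrow> ('g, 'c) monoid_scheme \<Rightarrow> ('g \<Rightarrow> 'a \<Rightarrow> 'a) \<Rightarrow> bool"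
  where "has_dense_orbit X H act \<longleftrightarrow>
     (\<exists>x\<in>topspace X. X closure_of (orbit H act x) = topspace X)"

definition topologically_isomorphic ::
  "('a, 'b) monoid_scheme \<Rightarrow> 'a topology \<Rightarrow> ('c, 'd) monoid_scheme \<Rightarrow> 'c topology \<Rightarrow> bool"
  where "topologically_isomorphic G X H Y \<longleftrightarrow> (\<exists>h\<in>iso G H. homeomorphic_map X Y h)"

definition circle_group :: "complex monoid"
  where "circle_group = \<lparr>carrier = sphere 0 1, mult = (*), one = 1\<rparr>"

abbreviation circle_topology :: "complex topology"
  where "circle_topology \<equiv> top_of_set (sphere 0 1)"

end

theory Submission
  imports Defs
begin

text \<open>
  In a chart \<open>\<psi>\<close> centred at the identity, \<open>\<psi>(xy) - \<psi>(x) - \<psi>(y)\<close> is twice continuously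
  differentiable and vanishes for \<open>x = 1\<close> and for \<open>y = 1\<close>, so it is \<open>O(\<bar>\<psi> x\<bar> \<bar>\<psi> y\<bar>)\<close>. For commutative multiplication this bound lets
  \<open>(\<psi>\<inverse>(v / 2\<^sup>k))\<close> raised to the power \<open>2\<^sup>k\<close> converge to a homomorphism \<open>E\<close> from the model space
  \<open>V\<close> onto the group. It has discrete kernel \<open>\<Gamma>\<close> and is open
  by invariance of domain. So the group is \<open>V / \<Gamma>\<close>, and linear automorphisms of \<open>V\<close> preserving
  \<open>\<Gamma>\<close> induce automorphisms of it.

  If \<open>\<Gamma>\<close> does not span \<open>V\<close>, take \<open>u \<noteq> 0\<close> orthogonal to it: the maps \<open>v \<mapsto> v + (u \<bullet> v) w\<close> move
  \<open>u\<close> to every point outside a hyperplane. If \<open>\<Gamma>\<close> spans \<open>V\<close> and \<open>dim V \<ge> 2\<close>, a basis of \<open>V\<close>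
  inside \<open>\<Gamma>\<close> suffices (it need not generate \<open>\<Gamma>\<close>): its coordinate functions have bounded
  denominators on \<open>\<Gamma>\<close>, so some multiples of them define transvections preserving \<open>\<Gamma>\<close>, and
  density of \<open>\<int>\<theta> + \<int>\<close> for irrational \<open>\<theta>\<close> fills one coordinate after the other. If \<open>dim V = 1\<close>
  and \<open>\<Gamma>\<close> spans, the group is the circle, whose only continuous automorphisms are the identity and
  inversion.
\<close>

section \<open>The mixed second difference of a twice continuously differentiable map\<close>

text \<open>Restricting \<open>f\<close> to the segment reduces this to the mean value inequality on
  \<open>{0..1}\<close>. Only the derivative in the direction \<open>w\<close> has to be bounded,
  which fits derivatives within \<open>V\<close>, whose values off \<open>V\<close> carry no
  information.\<close>

lemma norm_diff_segment_le:
  fixes f :: "'a::real_normed_vector \<Rightarrow> 'b::real_normed_vector"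
  assumes S: "\<And>t. t \<in> {0..1} \<Longrightarrow> a + t *\<^sub>R w \<in> S"
    and f': "\<And>x. x \<in> S \<Longrightarrow> (f has_derivative f' x) (at x within S)"
    and B: "\<And>t. t \<in> {0..1} \<Longrightarrow> norm (f' (a + t *\<^sub>R w) w) \<le> B"
  shows "norm (f (a + w) - f a) \<le> B"
proof -
  define g where "g = (\<lambda>t::real. f (a + t *\<^sub>R w))"
  have d: "(g has_derivative (\<lambda>h. h *\<^sub>R f' (a + t *\<^sub>R w) w)) (at t within {0..1})" if t: "t \<in> {0..1}" for t
  proof -
    have lin: "linear (f' (a + t *\<^sub>R w))"
      using f'[OF S[OF t]] has_derivative_linear by blast
    have "((\<lambda>t. a + t *\<^sub>R w) has_derivative (\<lambda>h. h *\<^sub>R w)) (at t within {0..1})"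
      by (auto intro!: derivative_eq_intros)
    moreover have "(f has_derivative f' (a + t *\<^sub>R w)) (at (a + t *\<^sub>R w) within (\<lambda>t. a + t *\<^sub>R w) ` {0..1})"
      by (rule has_derivative_subset[OF f'[OF S[OF t]]]) (use S in auto)
    ultimately have "((\<lambda>t. f (a + t *\<^sub>R w)) has_derivative (\<lambda>h. f' (a + t *\<^sub>R w) (h *\<^sub>R w))) (at t within {0..1})"
      using has_derivative_in_compose by blast
    then show ?thesis
      unfolding g_def by (simp add: linear_scale[OF lin])
  qed
  have on: "onorm (\<lambda>h. h *\<^sub>R f' (a + t *\<^sub>R w) w) \<le> B" if t: "t \<in> {0..1}" for t
    using B[OF t] by (intro onorm_le) (simp add: mult_left_mono mult.commute[of B])
  have "norm (g 1 - g 0) \<le> B * norm (1 - 0::real)"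
    by (rule differentiable_bound[OF _ d on]) auto
  then show ?thesis
    by (simp add: g_def)
qed

text \<open>The mean value inequality in \<open>x\<close>, applied to
  \<open>F (x, y) - F (x, p)\<close>, leaves a difference of first partial derivatives at
  \<open>(u, y)\<close> and \<open>(u, p)\<close>. A second application, now in \<open>y\<close>,
  bounds that difference by mixed second derivatives, which are bounded near \<open>(p, p)\<close>
  by continuity.\<close>

lemma second_difference_bound:
  fixes F :: "'e::euclidean_space \<times> 'e \<Rightarrow> 'f::real_normed_vector"
  assumes V: "subspace V" and F: "C_k 2 (V \<times> V) W F"
    and W: "openin (top_of_set (V \<times> V)) W" and p: "(p, p) \<in> W"
  obtains c r where "c > 0" "r > 0"
    "\<And>x y. x \<in> V \<Longrightarrow> y \<in> V \<Longrightarrow> norm (x - p) \<le> r \<Longrightarrow> norm (y - p) \<le> r \<Longrightarrow>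
       (x, y) \<in> W \<and> norm (F (x, y) - F (x, p) - F (p, y) + F (p, p)) \<le> c * norm (x - p) * norm (y - p)"
proof -
  obtain B where B: "B \<subseteq> V" "pairwise orthogonal B" "\<And>b. b \<in> B \<Longrightarrow> norm b = 1"
      "independent B" "span B = V"
    using orthonormal_basis_subspace[OF V] by metis
  have finB: "finite B"
    using B(4) independent_imp_finite by blast
  have expand: "(\<Sum>b\<in>B. (v \<bullet> b) *\<^sub>R b) = v" if "v \<in> V" for v
    using orthonormal_basis_expand[of B v] that B finB by simp
  have coeff: "\<bar>v \<bullet> b\<bar> \<le> norm v" if "b \<in> B" for b v
    using Cauchy_Schwarz_ineq2[of v b] B(3)[OF that] by simp
  \<comment> \<open>A substitute for the operator norm: \<open>C_k\<close> gives continuity of a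
    derivative only one direction at a time, so a linear map is bounded on \<open>V\<close> through
    its finitely many values on a basis.\<close>
  have lin_le: "norm (D v) \<le> norm v * (\<Sum>b\<in>B. norm (D b))" if "linear D" "v \<in> V" for D :: "'e \<Rightarrow> 'f" and v
  proof -
    have "D v = (\<Sum>b\<in>B. (v \<bullet> b) *\<^sub>R D b)"
      using expand[OF that(2)] that(1) by (metis (no_types, lifting) linear_scale linear_sum sum.cong)
    also have "norm \<dots> \<le> (\<Sum>b\<in>B. norm v * norm (D b))"
      by (rule sum_norm_le) (use coeff in \<open>auto intro!: mult_right_mono\<close>)
    finally show ?thesis
      by (simp add: sum_distrib_left)
  qed
  have pV: "p \<in> V"
    using p W openin_imp_subset by fastforce
  obtain F' where F': "\<And>z. z \<in> W \<Longrightarrow> (F has_derivative F' z) (at z within W)"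
      and F'1: "\<And>v. v \<in> V \<times> V \<Longrightarrow> C_k 1 (V \<times> V) W (\<lambda>z. F' z v)"
    using F unfolding Suc_1[symmetric] C_k.simps(2) by blast
  have "\<forall>b\<in>B. \<exists>H'. (\<forall>z\<in>W. ((\<lambda>z. F' z (b, 0)) has_derivative H' z) (at z within W)) \<and>
            (\<forall>v\<in>V \<times> V. continuous_on W (\<lambda>z. H' z v))"
    using F'1[of "(_, 0)"] B(1) subspace_0[OF V] by fastforce
  from bchoice[OF this] obtain H'
    where H': "\<And>b z. b \<in> B \<Longrightarrow> z \<in> W \<Longrightarrow> ((\<lambda>z. F' z (b, 0)) has_derivative H' b z) (at z within W)"
      and H'c: "\<And>b v. b \<in> B \<Longrightarrow> v \<in> V \<times> V \<Longrightarrow> continuous_on W (\<lambda>z. H' b z v)"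
    by blast
  \<comment> \<open>Only mixed second derivatives occur: first a direction \<open>b\<close> in the
    first factor, then a direction \<open>d\<close> in the second.\<close>
  define S where "S = (\<lambda>z. \<Sum>b\<in>B. \<Sum>d\<in>B. norm (H' b z (0, d)))"
  have "continuous_on W S"
    unfolding S_def using B(1) subspace_0[OF V]
    by (intro continuous_on_sum continuous_on_norm H'c) auto
  then obtain R1 where R1: "R1 > 0" "\<And>z. z \<in> W \<Longrightarrow> dist z (p, p) < R1 \<Longrightarrow> S z < S (p, p) + 1"
  proof -
    obtain d where "d > 0" "\<And>z. z \<in> W \<Longrightarrow> dist z (p, p) < d \<Longrightarrow> dist (S z) (S (p, p)) < 1"
      using \<open>continuous_on W S\<close> p unfolding continuous_on_iff by (meson zero_less_one)
    then show ?thesis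
      using that unfolding dist_real_def by fastforce
  qed
  obtain R2 where R2: "R2 > 0" "ball (p, p) R2 \<inter> (V \<times> V) \<subseteq> W"
    using W p openin_contains_ball by (metis)
  \<comment> \<open>A third, because the distance from \<open>(x, y)\<close> to
    \<open>(p, p)\<close> may reach \<open>2 * r\<close> and has to stay strictly below both
    radii.\<close>
  define r where "r = min R1 R2 / 3"
  have r: "r > 0" "2 * r < R1" "2 * r < R2"
    using R1 R2 by (auto simp: r_def)
  define M where "M = S (p, p) + 1"
  have S0: "S z \<ge> 0" for z
    unfolding S_def by (intro sum_nonneg) auto
  have near: "(x, y) \<in> W \<and> S (x, y) \<le> M" if "x \<in> V" "y \<in> V" "norm (x - p) \<le> r" "norm (y - p) \<le> r" for x y
  proof -
    have "dist (x, y) (p, p) \<le> norm (x - p) + norm (y - p)"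
      unfolding dist_norm by (metis add_Pair diff_Pair diff_zero norm_Pair_le)
    then have "dist (x, y) (p, p) < R1" "dist (x, y) (p, p) < R2"
      using that r by auto
    then show ?thesis
      using that R1(2)[of "(x, y)"] R2(2) by (auto simp: M_def dist_commute subset_iff less_imp_le)
  qed
  have seg: "a + t *\<^sub>R (b - a) \<in> V \<and> norm (a + t *\<^sub>R (b - a) - p) \<le> r"
    if "a \<in> V" "b \<in> V" "norm (a - p) \<le> r" "norm (b - p) \<le> r" "t \<in> {0..1}" for a b t
  proof -
    have "a + t *\<^sub>R (b - a) - p = (1 - t) *\<^sub>R (a - p) + t *\<^sub>R (b - p)"
      by (simp add: algebra_simps)
    then have "norm (a + t *\<^sub>R (b - a) - p) \<le> (1 - t) * norm (a - p) + t * norm (b - p)"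
      using norm_triangle_ineq[of "(1 - t) *\<^sub>R (a - p)" "t *\<^sub>R (b - p)"] that(5) by simp
    also have "\<dots> \<le> r"
      using that convex_bound_le[of "norm (a - p)" r "norm (b - p)" "1 - t" t] by auto
    finally show ?thesis
      using that by (auto intro!: subspace_add subspace_scale subspace_diff V)
  qed
  have step1: "norm (F' (x, y) (b, 0) - F' (x, p) (b, 0)) \<le> M * norm (y - p)"
    if "x \<in> V" "y \<in> V" "norm (x - p) \<le> r" "norm (y - p) \<le> r" "b \<in> B" for x y b
  proof -
    have *: "(x, p) + t *\<^sub>R (0, y - p) \<in> W \<and> S ((x, p) + t *\<^sub>R (0, y - p)) \<le> M" if "t \<in> {0..1}" for t
      using near[of x "p + t *\<^sub>R (y - p)"] seg[of p y t] \<open>x \<in> V\<close> \<open>y \<in> V\<close> pV r(1)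
        \<open>norm (x - p) \<le> r\<close> \<open>norm (y - p) \<le> r\<close> that by simp
    have "norm (F' ((x, p) + (0, y - p)) (b, 0) - F' (x, p) (b, 0)) \<le> M * norm (y - p)"
    proof (rule norm_diff_segment_le[where S = W and f' = "H' b"])
      fix t :: real assume t: "t \<in> {0..1}"
      let ?z = "(x, p) + t *\<^sub>R (0, y - p)"
      have lin: "linear (H' b ?z)"
        using H'[OF that(5)] * t has_derivative_linear by blast
      have "linear (\<lambda>w. H' b ?z (0, w))"
        using linear_compose[OF linearI lin, of "\<lambda>w. (0, w)"] by (simp add: o_def)
      then have "norm (H' b ?z (0, y - p)) \<le> norm (y - p) * (\<Sum>d\<in>B. norm (H' b ?z (0, d)))"
        by (rule lin_le[of "\<lambda>w. H' b ?z (0, w)"]) (use V that pV in \<open>auto intro: subspace_diff\<close>)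
      also have "(\<Sum>d\<in>B. norm (H' b ?z (0, d))) \<le> S ?z"
        unfolding S_def using finB that(5)
        by (intro member_le_sum[of b B "\<lambda>b. \<Sum>d\<in>B. norm (H' b ?z (0, d))"]) (auto intro: sum_nonneg)
      also have "\<dots> \<le> M"
        using * t by blast
      finally show "norm (H' b ?z (0, y - p)) \<le> M * norm (y - p)"
        by (simp add: mult.commute[of M] mult_left_mono)
    qed (use * H' that in auto)
    then show ?thesis by simp
  qed
  \<comment> \<open>The added 1 keeps \<open>c\<close> positive when \<open>B\<close> is empty, that
    is, when \<open>V = {0}\<close>.\<close>
  define c where "c = real (card B) * M + 1"
  have c: "c > 0"
    unfolding c_def M_def using S0[of "(p, p)"] by (simp add: add_nonneg_pos)
  show thesis
  proof (rule that[OF c r(1)], intro conjI)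
    fix x y assume xy: "x \<in> V" "y \<in> V" "norm (x - p) \<le> r" "norm (y - p) \<le> r"
    show "(x, y) \<in> W"
      using near xy by blast
    define W1 where "W1 = {x \<in> V. norm (x - p) \<le> r}"
    have inW: "(u, y) \<in> W" "(u, p) \<in> W" if "u \<in> W1" for u
      using near xy pV r that by (auto simp: W1_def)
    define G where "G = (\<lambda>u. F (u, y) - F (u, p))"
    have dF: "((\<lambda>u. F (u, q)) has_derivative (\<lambda>h. F' (u, q) (h, 0))) (at u within W1)"
      if "u \<in> W1" and q: "q = y \<or> q = p" for u q
    proof -
      have "((\<lambda>u. (u, q)) has_derivative (\<lambda>h. (h, 0))) (at u within W1)"
        by (auto intro!: derivative_eq_intros)
      moreover have "(F has_derivative F' (u, q)) (at (u, q) within (\<lambda>u. (u, q)) ` W1)"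
        by (rule has_derivative_subset[OF F']) (use inW that in auto)
      ultimately show ?thesis
        using has_derivative_in_compose by blast
    qed
    have "norm (G (p + (x - p)) - G p) \<le> c * norm (x - p) * norm (y - p)"
    proof (rule norm_diff_segment_le[where S = W1 and f' = "\<lambda>u h. F' (u, y) (h, 0) - F' (u, p) (h, 0)"])
      fix t :: real assume t: "t \<in> {0..1}"
      let ?u = "p + t *\<^sub>R (x - p)"
      show u: "?u \<in> W1"
        using seg[of p x t] xy pV r t by (simp add: W1_def)
      let ?D = "\<lambda>h. F' (?u, y) (h, 0) - F' (?u, p) (h, 0)"
      have "linear ?D"
        using dF[OF u] by (intro linear_compose_sub) (auto dest: has_derivative_linear)
      then have "norm (?D (x - p)) \<le> norm (x - p) * (\<Sum>b\<in>B. norm (?D b))"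
        by (rule lin_le) (use V xy pV in \<open>auto intro: subspace_diff\<close>)
      also have "(\<Sum>b\<in>B. norm (?D b)) \<le> real (card B) * (M * norm (y - p))"
        using step1 u xy by (intro sum_bounded_above) (auto simp: W1_def)
      also have "\<dots> \<le> c * norm (y - p)"
        by (simp add: c_def algebra_simps)
      finally show "norm (?D (x - p)) \<le> c * norm (x - p) * norm (y - p)"
        by (simp add: mult_left_mono mult.assoc mult.left_commute[of c])
    next
      fix u assume "u \<in> W1"
      then show "(G has_derivative (\<lambda>h. F' (u, y) (h, 0) - F' (u, p) (h, 0))) (at u within W1)"
        unfolding G_def using dF by (intro has_derivative_diff) auto
    qed
    then show "norm (F (x, y) - F (x, p) - F (p, y) + F (p, p)) \<le> c * norm (x - p) * norm (y - p)"
      by (simp add: G_def algebra_simps)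
  qed
qed

section \<open>The exponential map of a chart\<close>

text \<open>The steps are dominated by a geometric series with sum \<open>2 * M\<close>, so the
  telescoping series converges absolutely.\<close>

lemma geometric_steps_converge:
  fixes a :: "nat \<Rightarrow> 'e::banach"
  assumes step: "\<And>k. norm (a (Suc k) - a k) \<le> M / 2 ^ k"
  obtains w where "a \<longlonglongrightarrow> w" "norm (w - a 0) \<le> 2 * M"
proof -
  define d where "d = (\<lambda>k. a (Suc k) - a k)"
  have g: "(\<lambda>k. M / 2 ^ k) sums (2 * M)"
    using sums_mult[OF geometric_sums[of "1/2::real"], of M] by (simp add: power_one_over field_simps)
  have sm: "summable (\<lambda>k. norm (d k))"
    by (rule summable_comparison_test'[of "\<lambda>k. M / 2 ^ k" 0]) (use g step in \<open>auto simp: d_def sums_iff\<close>)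
  then have "d sums suminf d"
    using summable_norm_cancel summable_sums by blast
  moreover have "(\<Sum>j<k. d j) = a k - a 0" for k
    unfolding d_def by (rule sum_lessThan_telescope)
  ultimately have "(\<lambda>k. a k - a 0) \<longlonglongrightarrow> suminf d"
    by (simp add: sums_def)
  then have lim: "a \<longlonglongrightarrow> suminf d + a 0"
    using tendsto_add[OF _ tendsto_const[of "a 0"]] by force
  have "norm (suminf d) \<le> (\<Sum>k. norm (d k))"
    by (rule summable_norm[OF sm])
  also have "\<dots> \<le> 2 * M"
    using suminf_le[of "\<lambda>k. norm (d k)" "\<lambda>k. M / 2 ^ k"] step sm g by (simp add: d_def sums_iff)
  finally show thesis
    using that[OF lim] by simp
qed

lemma eventually_divide_power_two_le:
  fixes a :: real
  assumes "e > 0"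
  shows "\<exists>N. \<forall>k\<ge>N. a / 2 ^ k \<le> e"
proof -
  have "\<forall>\<^sub>F k in sequentially. a / 2 ^ k < e"
    by (rule order_tendstoD(2)[OF LIMSEQ_divide_realpow_zero]) (use assms in auto)
  then show ?thesis
    by (meson eventually_sequentially less_imp_le)
qed

section \<open>Commutative topological groups and charts centred at the identity\<close>

locale comm_topological_group = comm_group G for G (structure) +
  fixes X :: "'a topology"
  assumes topspace_X: "topspace X = carrier G"
    and Hausdorff_X: "Hausdorff_space X"
    and continuous_mult: "continuous_map (prod_topology X X) X (\<lambda>(x, y). x \<otimes> y)"
    and continuous_inv: "continuous_map X X (\<lambda>x. inv x)"
begin

lemma limitin_mult:
  assumes "limitin X f a F" "limitin X g b F"
  shows "limitin X (\<lambda>k. f k \<otimes> g k) (a \<otimes> b) F"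
proof -
  have "limitin (prod_topology X X) (\<lambda>k. (f k, g k)) (a, b) F"
    using assms by (simp add: limitin_pairwise o_def)
  from continuous_map_limit[OF continuous_mult this] show ?thesis
    by (simp add: o_def)
qed

lemma limitin_pow: "limitin X f a F \<Longrightarrow> limitin X (\<lambda>k. f k [^] (n::nat)) (a [^] n) F"
proof (induction n)
  case 0
  then show ?case
    by (simp add: topspace_X)
next
  case (Suc n)
  then show ?case
    using limitin_mult[of "\<lambda>k. f k [^] n"] by simp
qed

lemma continuous_translation:
  assumes "a \<in> carrier G"
  shows "continuous_map X X (\<lambda>x. a \<otimes> x)"
proof -
  have "continuous_map X (prod_topology X X) (\<lambda>x. (a, x))"
    by (simp add: continuous_map_pairwise o_def topspace_X assms)
  from continuous_map_compose[OF this continuous_mult] show ?thesis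
    by (simp add: o_def)
qed

lemma openin_translation:
  assumes a: "a \<in> carrier G" and W: "openin X W"
  shows "openin X ((\<lambda>x. a \<otimes> x) ` W)"
proof -
  have "W \<subseteq> carrier G"
    using W openin_subset topspace_X by blast
  moreover have "a \<otimes> (inv a \<otimes> x) = x" "inv a \<otimes> (a \<otimes> x) = x" if "x \<in> carrier G" for x
    using a that by (simp_all add: m_assoc[symmetric])
  ultimately have "(\<lambda>x. a \<otimes> x) ` W = {x \<in> topspace X. inv a \<otimes> x \<in> W}"
    using a by (force simp: topspace_X subset_iff image_iff)
  then show ?thesis
    using openin_continuous_map_preimage[OF continuous_translation W, of "inv a"] a by simp
qed

end

lemma is_chart_open_image:
  assumes "is_chart X V (U, \<phi>)" "openin X W" "W \<subseteq> U"
  shows "openin (top_of_set V) (\<phi> ` W)"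
proof -
  have "openin (subtopology X U) W"
    using assms by (simp add: is_chart_def openin_open_subtopology)
  then have "openin (top_of_set (\<phi> ` U)) (\<phi> ` W)"
    using assms(1) homeomorphic_imp_open_map by (auto simp: is_chart_def open_map_def)
  then show ?thesis
    using assms(1) openin_trans by (auto simp: is_chart_def)
qed

text \<open>The exponential map is built from these assumptions alone. Smoothness survives only in
  \<open>mult_bound\<close>: up to an error of second order, the chart turns multiplication into
  addition of vectors.\<close>

locale additive_chart = comm_topological_group +
  fixes V :: "'e::euclidean_space set" and U :: "'a set" and \<psi> :: "'a \<Rightarrow> 'e" and C r :: real
  assumes subspace_V: "subspace V"
    and open_U: "openin X U"
    and one_U: "\<one> \<in> U"
    and homeo: "homeomorphic_map (subtopology X U) (top_of_set (\<psi> ` U)) \<psi>"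
    and open_image: "openin (top_of_set V) (\<psi> ` U)"
    and \<psi>_one: "\<psi> \<one> = 0"
    and C_pos: "C > 0" and r_pos: "r > 0"
    and ball_image: "cball 0 r \<inter> V \<subseteq> \<psi> ` U"
    and mult_bound: "\<And>x y. x \<in> U \<Longrightarrow> y \<in> U \<Longrightarrow> norm (\<psi> x) \<le> r \<Longrightarrow> norm (\<psi> y) \<le> r \<Longrightarrow>
          x \<otimes> y \<in> U \<and> norm (\<psi> (x \<otimes> y) - \<psi> x - \<psi> y) \<le> C * norm (\<psi> x) * norm (\<psi> y)"
begin

definition p :: "'e \<Rightarrow> 'a" where "p = inv_into U \<psi>"

lemma U_carrier: "U \<subseteq> carrier G"
  using open_U openin_subset topspace_X by blast

lemma inj_\<psi>: "inj_on \<psi> U"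
proof -
  have "topspace (subtopology X U) = U"
    using U_carrier by (auto simp: topspace_X)
  then show ?thesis
    using homeomorphic_imp_injective_map[OF homeo] by simp
qed

lemma p_\<psi> [simp]: "x \<in> U \<Longrightarrow> p (\<psi> x) = x"
  by (simp add: p_def inj_\<psi>)

lemma \<psi>_V: "x \<in> U \<Longrightarrow> \<psi> x \<in> V"
  using open_image openin_imp_subset by blast

lemma p_ball:
  assumes "v \<in> V" "norm v \<le> r"
  shows "p v \<in> U" "\<psi> (p v) = v" "p v \<in> carrier G"
proof -
  have "v \<in> \<psi> ` U"
    using ball_image assms by auto
  then show "p v \<in> U" "\<psi> (p v) = v"
    by (auto simp: p_def inv_into_into f_inv_into_f)
  then show "p v \<in> carrier G"
    using U_carrier by blast
qed

lemma is_chart_\<psi>: "is_chart X V (U, \<psi>)"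
  by (simp add: is_chart_def open_U open_image homeo)

lemmas open_chart_image = is_chart_open_image[OF is_chart_\<psi>]

lemma open_chart_preimage:
  assumes "openin (top_of_set V) S"
  shows "openin X {x \<in> U. \<psi> x \<in> S}"
proof -
  have S: "openin (top_of_set (\<psi> ` U)) (S \<inter> \<psi> ` U)"
  proof -
    have "\<psi> ` U \<subseteq> V" using \<psi>_V by blast
    moreover obtain T where "open T" "S = V \<inter> T"
      using assms by (auto simp: openin_open)
    ultimately show ?thesis
      unfolding openin_open by blast
  qed
  have "topspace (subtopology X U) = U"
    using U_carrier by (auto simp: topspace_X)
  then have "openin (subtopology X U) {x \<in> U. \<psi> x \<in> S \<inter> \<psi> ` U}"
    using openin_continuous_map_preimage[OF homeomorphic_imp_continuous_map[OF homeo] S] by simp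
  moreover have "{x \<in> U. \<psi> x \<in> S \<inter> \<psi> ` U} = {x \<in> U. \<psi> x \<in> S}"
    by auto
  ultimately show ?thesis
    by (simp add: openin_open_subtopology open_U)
qed

lemma open_chart_ball: "openin X {x \<in> U. norm (\<psi> x) < e}"
proof -
  have "openin (top_of_set V) (V \<inter> ball 0 e)"
    by auto
  moreover have "{x \<in> U. \<psi> x \<in> V \<inter> ball 0 e} = {x \<in> U. norm (\<psi> x) < e}"
    using \<psi>_V by auto
  ultimately show ?thesis
    using open_chart_preimage by metis
qed

text \<open>Together with \<open>open_chart_ball\<close>, this makes the chart balls a neighbourhood
  basis of \<open>\<one>\<close>.\<close>

lemma chart_ball_subset:
  assumes "openin X W" "\<one> \<in> W"
  obtains e where "e > 0" "\<And>x. x \<in> U \<Longrightarrow> norm (\<psi> x) < e \<Longrightarrow> x \<in> W"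
proof -
  have "openin X (U \<inter> W)"
    using assms open_U by blast
  then have "openin (top_of_set V) (\<psi> ` (U \<inter> W))"
    by (rule open_chart_image) auto
  moreover have "0 \<in> \<psi> ` (U \<inter> W)"
    using one_U assms \<psi>_one by force
  ultimately obtain e where e: "e > 0" "ball 0 e \<inter> V \<subseteq> \<psi> ` (U \<inter> W)"
    unfolding openin_contains_ball by blast
  show thesis
  proof (rule that[OF e(1)])
    fix x assume x: "x \<in> U" "norm (\<psi> x) < e"
    then have "\<psi> x \<in> \<psi> ` (U \<inter> W)"
      using e \<psi>_V by auto
    then show "x \<in> W"
      using x inj_\<psi> by (auto dest: inj_onD)
  qed
qed

text \<open>Since \<open>\<psi>\<close> maps open subsets of \<open>U\<close> to relatively open
  subsets of \<open>V\<close>, convergence can be checked in coordinates.\<close>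

lemma limitin_chart:
  assumes f: "\<forall>\<^sub>F k in F. f k \<in> U" and lim: "((\<lambda>k. \<psi> (f k)) \<longlongrightarrow> w) F" and w: "w \<in> \<psi> ` U"
  shows "limitin X f (p w) F"
  unfolding limitin_def
proof (intro conjI allI impI)
  have pw: "p w \<in> U" "\<psi> (p w) = w"
    using w by (auto simp: p_def inv_into_into f_inv_into_f)
  then show "p w \<in> topspace X"
    using U_carrier topspace_X by blast
  fix W assume W: "openin X W \<and> p w \<in> W"
  then have "openin X (U \<inter> W)"
    using open_U by blast
  then have "openin (top_of_set V) (\<psi> ` (U \<inter> W))"
    by (rule open_chart_image) auto
  moreover have "w \<in> \<psi> ` (U \<inter> W)"
    using pw W by force
  ultimately obtain e where e: "e > 0" "ball w e \<inter> V \<subseteq> \<psi> ` (U \<inter> W)"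
    unfolding openin_contains_ball by blast
  have "\<forall>\<^sub>F k in F. dist (\<psi> (f k)) w < e"
    using lim e(1) by (rule tendstoD)
  with f show "\<forall>\<^sub>F k in F. f k \<in> W"
  proof eventually_elim
    case (elim k)
    then have "\<psi> (f k) \<in> \<psi> ` (U \<inter> W)"
      using e(2) \<psi>_V by (auto simp: dist_commute)
    then show ?case
      using elim inj_\<psi> by (auto dest: inj_onD)
  qed
qed

lemma limitin_one:
  assumes "\<forall>\<^sub>F k in F. f k \<in> U" "((\<lambda>k. \<psi> (f k)) \<longlongrightarrow> 0) F"
  shows "limitin X f \<one> F"
  using limitin_chart[OF assms] one_U \<psi>_one by (metis image_eqI p_\<psi>)

section \<open>Estimates for powers and quotients in the chart\<close>

text \<open>
  The bound \<open>a + C a\<^sup>2\<close> with \<open>a = 2\<^sup>k \<bar>\<psi> x\<bar>\<close> is the one that the induction on \<open>k\<close> reproduces; the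
  bound \<open>2 a\<close> alone would not.
\<close>

lemma pow_two_bound:
  assumes "x \<in> U" "2 ^ k * norm (\<psi> x) \<le> r / 2" "2 ^ k * norm (\<psi> x) \<le> 1 / (4 * C)"
  shows "x [^] ((2::nat) ^ k) \<in> U \<and> norm (\<psi> (x [^] ((2::nat) ^ k))) \<le> 2 * (2 ^ k * norm (\<psi> x))"
proof -
  have "x [^] ((2::nat) ^ k) \<in> U \<and>
        norm (\<psi> (x [^] ((2::nat) ^ k))) \<le> 2 ^ k * norm (\<psi> x) + C * (2 ^ k * norm (\<psi> x))\<^sup>2"
    using assms
  proof (induction k)
    case 0
    then show ?case
      using U_carrier C_pos by (auto simp: subset_iff)
  next
    case (Suc k)
    define a where "a = 2 ^ k * norm (\<psi> x)"
    define y where "y = x [^] ((2::nat) ^ k)"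
    have a: "0 \<le> a" "2 * a \<le> r / 2" "2 * a \<le> 1 / (4 * C)"
      using Suc.prems by (auto simp: a_def)
    then have y: "y \<in> U" "norm (\<psi> y) \<le> a + C * a\<^sup>2"
    proof -
      have "a \<le> r / 2" "a \<le> 1 / (4 * C)"
        using a by linarith+
      then show "y \<in> U" "norm (\<psi> y) \<le> a + C * a\<^sup>2"
        using Suc.IH[OF Suc.prems(1)] by (auto simp: a_def y_def)
    qed
    have Ca: "C * a \<le> 1 / 8"
      using a(3) C_pos by (simp add: field_simps)
    have "C * a\<^sup>2 \<le> a"
      using mult_right_mono[OF Ca a(1)] a(1) by (simp add: power2_eq_square)
    then have "norm (\<psi> y) \<le> r"
      using y a r_pos by auto
    then have yy: "y \<otimes> y \<in> U" "norm (\<psi> (y \<otimes> y) - \<psi> y - \<psi> y) \<le> C * norm (\<psi> y) * norm (\<psi> y)"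
      using mult_bound y by auto
    have xk: "x [^] ((2::nat) ^ Suc k) = y \<otimes> y"
      using nat_pow_mult[of x "2 ^ k" "2 ^ k"] assms(1) U_carrier by (auto simp: y_def mult_2)
    have "norm (\<psi> (y \<otimes> y)) \<le> norm (\<psi> (y \<otimes> y) - \<psi> y - \<psi> y) + norm (\<psi> y) + norm (\<psi> y)"
      by (smt (verit, best) norm_triangle_ineq2)
    also have "\<dots> \<le> C * (norm (\<psi> y))\<^sup>2 + 2 * norm (\<psi> y)"
      using yy(2) by (simp add: power2_eq_square)
    also have "\<dots> \<le> C * (a + C * a\<^sup>2)\<^sup>2 + 2 * (a + C * a\<^sup>2)"
      using y(2) C_pos by (intro add_mono mult_left_mono power_mono) auto
    also have "(a + C * a\<^sup>2)\<^sup>2 = a\<^sup>2 * (1 + C * a)\<^sup>2"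
      by (simp add: power2_eq_square algebra_simps)
    finally have le: "norm (\<psi> (y \<otimes> y)) \<le> C * (a\<^sup>2 * (1 + C * a)\<^sup>2) + 2 * (a + C * a\<^sup>2)" .
    have "(1 + C * a)\<^sup>2 \<le> (1 + 1 / 8)\<^sup>2"
      using Ca a(1) C_pos by (intro power_mono) auto
    also have "(1 + 1 / 8 :: real)\<^sup>2 \<le> 2"
      by (simp add: power2_eq_square)
    finally have "C * (a\<^sup>2 * (1 + C * a)\<^sup>2) \<le> C * (a\<^sup>2 * 2)"
      using C_pos by (intro mult_left_mono) auto
    then have "norm (\<psi> (y \<otimes> y)) \<le> 2 * a + C * (2 * a)\<^sup>2"
      using le by (simp add: power2_eq_square algebra_simps)
    then show ?case
      using yy(1) xk by (simp add: a_def mult.assoc)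
  qed
  moreover have "C * (2 ^ k * norm (\<psi> x))\<^sup>2 \<le> 2 ^ k * norm (\<psi> x)"
  proof -
    have "C * (2 ^ k * norm (\<psi> x)) \<le> 1"
      using assms(3) C_pos by (simp add: field_simps)
    then show ?thesis
      using mult_right_mono[of "C * (2 ^ k * norm (\<psi> x))" 1 "2 ^ k * norm (\<psi> x)"]
      by (simp add: power2_eq_square mult.assoc)
  qed
  ultimately show ?thesis by linarith
qed

text \<open>Continuity of \<open>x \<otimes> inv y\<close> at the identity puts the quotient
  \<open>z\<close> into the chart. Then \<open>x = y \<otimes> z\<close> and
  \<open>mult_bound\<close> give \<open>norm (\<psi> x - \<psi> y - \<psi> z) \<le> 1 / 2 * norm
  (\<psi> z)\<close>, and the right side is absorbed. Closeness in coordinates thus becomes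
  smallness of the group quotient.\<close>

lemma quotient_bound:
  "\<exists>e>0. \<forall>x\<in>U. \<forall>y\<in>U. norm (\<psi> x) \<le> e \<longrightarrow> norm (\<psi> y) \<le> e \<longrightarrow>
     x \<otimes> inv y \<in> U \<and> norm (\<psi> (x \<otimes> inv y)) \<le> 2 * norm (\<psi> x - \<psi> y)"
proof -
  define W where "W = {x \<in> U. norm (\<psi> x) < r}"
  have W: "openin X W" "\<one> \<in> W"
    using open_chart_ball one_U \<psi>_one r_pos by (auto simp: W_def)
  have "continuous_map (prod_topology X X) X ((\<lambda>(x, y). x \<otimes> y) \<circ> (\<lambda>(x, y). (x, inv y)))"
    by (rule continuous_map_compose[OF _ continuous_mult])
      (auto simp: continuous_map_pairwise o_def case_prod_unfold continuous_map_fst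
        intro: continuous_map_compose[OF continuous_map_snd continuous_inv, unfolded o_def])
  then have "openin (prod_topology X X)
      {z \<in> topspace (prod_topology X X). ((\<lambda>(x, y). x \<otimes> y) \<circ> (\<lambda>(x, y). (x, inv y))) z \<in> W}"
    using openin_continuous_map_preimage W(1) by blast
  moreover have "(\<one>, \<one>) \<in> {z \<in> topspace (prod_topology X X). ((\<lambda>(x, y). x \<otimes> y) \<circ> (\<lambda>(x, y). (x, inv y))) z \<in> W}"
    using W(2) by (simp add: topspace_X)
  ultimately obtain W1 W2 where W12: "openin X W1" "openin X W2" "\<one> \<in> W1" "\<one> \<in> W2"
     "W1 \<times> W2 \<subseteq> {z \<in> topspace (prod_topology X X). ((\<lambda>(x, y). x \<otimes> y) \<circ> (\<lambda>(x, y). (x, inv y))) z \<in> W}"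
    unfolding openin_prod_topology_alt by meson
  have "openin X (W1 \<inter> W2)" "\<one> \<in> W1 \<inter> W2"
    using W12 by auto
  then obtain e0 where e0: "e0 > 0" "\<And>x. x \<in> U \<Longrightarrow> norm (\<psi> x) < e0 \<Longrightarrow> x \<in> W1 \<inter> W2"
    using chart_ball_subset by metis
  define e where "e = min (e0 / 2) (min r (1 / (2 * C)))"
  have e: "e > 0" "e < e0" "e \<le> r" "e \<le> 1 / (2 * C)"
    using e0(1) r_pos C_pos by (auto simp: e_def)
  have "x \<otimes> inv y \<in> U \<and> norm (\<psi> (x \<otimes> inv y)) \<le> 2 * norm (\<psi> x - \<psi> y)"
    if xy: "x \<in> U" "y \<in> U" "norm (\<psi> x) \<le> e" "norm (\<psi> y) \<le> e" for x y
  proof -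
    define z where "z = x \<otimes> inv y"
    have c: "x \<in> carrier G" "y \<in> carrier G"
      using xy U_carrier by auto
    have "x \<in> W1" "y \<in> W2"
      using e0(2) xy e(2) by force+
    then have z: "z \<in> U" "norm (\<psi> z) < r"
      using W12(5) by (auto simp: z_def W_def)
    have "x = y \<otimes> z"
      using c by (simp add: z_def m_lcomm)
    then have "norm (\<psi> x - \<psi> y - \<psi> z) \<le> C * norm (\<psi> y) * norm (\<psi> z)"
      using mult_bound[of y z] z xy e by simp
    also have "\<dots> \<le> 1 / 2 * norm (\<psi> z)"
    proof -
      have "C * norm (\<psi> y) \<le> 1 / 2"
      proof -
        have "C * e \<le> 1 / 2"
          using e(4) C_pos by (simp add: field_simps)
        then show ?thesis
          using mult_left_mono[OF xy(4), of C] C_pos by linarith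
      qed
      then show ?thesis
        by (intro mult_right_mono) auto
    qed
    finally show ?thesis
      using z(1) norm_triangle_ineq2[of "\<psi> z" "\<psi> x - \<psi> y"] unfolding z_def[symmetric]
      by (simp add: norm_minus_commute)
  qed
  then show ?thesis
    using e(1) by blast
qed

text \<open>One radius for all later estimates, fixed by \<open>SOME\<close> so that they share it.
  The bound \<open>1 / (32 * C)\<close> leaves room for the constants that accumulate; the quotient
  estimate reaches up to \<open>2 * d\<close> because the product of two small elements may leave
  the ball of radius \<open>d\<close>.\<close>

definition d :: real where
  "d = (SOME d. 0 < d \<and> d \<le> r / 4 \<and> d \<le> 1 / (32 * C) \<and>
     (\<forall>x\<in>U. \<forall>y\<in>U. norm (\<psi> x) \<le> 2 * d \<longrightarrow> norm (\<psi> y) \<le> 2 * d \<longrightarrow>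
        x \<otimes> inv y \<in> U \<and> norm (\<psi> (x \<otimes> inv y)) \<le> 2 * norm (\<psi> x - \<psi> y)))"

lemma d_bounds: "0 < d" "d \<le> r / 4" "d \<le> 1 / (32 * C)"
  and quotient_le: "\<And>x y. x \<in> U \<Longrightarrow> y \<in> U \<Longrightarrow> norm (\<psi> x) \<le> 2 * d \<Longrightarrow> norm (\<psi> y) \<le> 2 * d \<Longrightarrow>
        x \<otimes> inv y \<in> U \<and> norm (\<psi> (x \<otimes> inv y)) \<le> 2 * norm (\<psi> x - \<psi> y)"
proof -
  obtain e where e: "e > 0" "\<forall>x\<in>U. \<forall>y\<in>U. norm (\<psi> x) \<le> e \<longrightarrow> norm (\<psi> y) \<le> e \<longrightarrow>
     x \<otimes> inv y \<in> U \<and> norm (\<psi> (x \<otimes> inv y)) \<le> 2 * norm (\<psi> x - \<psi> y)"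
    using quotient_bound by blast
  let ?P = "\<lambda>d. 0 < d \<and> d \<le> r / 4 \<and> d \<le> 1 / (32 * C) \<and>
     (\<forall>x\<in>U. \<forall>y\<in>U. norm (\<psi> x) \<le> 2 * d \<longrightarrow> norm (\<psi> y) \<le> 2 * d \<longrightarrow>
        x \<otimes> inv y \<in> U \<and> norm (\<psi> (x \<otimes> inv y)) \<le> 2 * norm (\<psi> x - \<psi> y))"
  define d' where "d' = min (e / 2) (min (r / 4) (1 / (32 * C)))"
  have "?P d'"
  proof (intro conjI ballI impI)
    fix x y assume xy: "x \<in> U" "y \<in> U" "norm (\<psi> x) \<le> 2 * d'" "norm (\<psi> y) \<le> 2 * d'"
    have "2 * d' \<le> e" by (simp add: d'_def)
    then show "x \<otimes> inv y \<in> U" "norm (\<psi> (x \<otimes> inv y)) \<le> 2 * norm (\<psi> x - \<psi> y)"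
      using e(2) xy by (meson order_trans)+
  qed (use e(1) r_pos C_pos in \<open>auto simp: d'_def\<close>)
  then have "?P d"
    unfolding d_def by (rule someI[of ?P])
  then show "0 < d" "d \<le> r / 4" "d \<le> 1 / (32 * C)"
    "\<And>x y. x \<in> U \<Longrightarrow> y \<in> U \<Longrightarrow> norm (\<psi> x) \<le> 2 * d \<Longrightarrow> norm (\<psi> y) \<le> 2 * d \<Longrightarrow>
        x \<otimes> inv y \<in> U \<and> norm (\<psi> (x \<otimes> inv y)) \<le> 2 * norm (\<psi> x - \<psi> y)"
    by blast+
qed

lemma C_mult_d: "C * d \<le> 1 / 32"
  using d_bounds(3) C_pos by (simp add: field_simps)

section \<open>Construction of the exponential map by dyadic powers\<close>

lemma pow_two_le:
  assumes "x \<in> U" "2 ^ k * norm (\<psi> x) \<le> 2 * d"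
  shows "x [^] ((2::nat) ^ k) \<in> U" "norm (\<psi> (x [^] ((2::nat) ^ k))) \<le> 2 * (2 ^ k * norm (\<psi> x))"
proof -
  have "2 * d \<le> 1 / (4 * C)"
    using d_bounds(3) C_pos by (simp add: field_simps)
  then show "x [^] ((2::nat) ^ k) \<in> U" "norm (\<psi> (x [^] ((2::nat) ^ k))) \<le> 2 * (2 ^ k * norm (\<psi> x))"
    using pow_two_bound[of x k] assms d_bounds by linarith+
qed

text \<open>The square of \<open>x (Suc k)\<close> differs from \<open>x k\<close> by a factor
  \<open>z\<close> whose size is of the order of the square of \<open>norm v / 2 ^ k\<close>.
  Raising to the power \<open>2 ^ k\<close> multiplies that size by about \<open>2 ^ k\<close>, so
  the steps of \<open>g\<close> still decay like \<open>(norm v)\<^sup>2 / 2 ^ k\<close>, and their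
  sum gives the quadratic distance of the limit from \<open>v\<close>.\<close>

lemma dyadic_powers_converge:
  assumes v: "v \<in> V" "norm v \<le> d"
  obtains w where "w \<in> V" "norm w \<le> 2 * norm v" "norm (w - v) \<le> 4 * C * (norm v)\<^sup>2"
    "limitin X (\<lambda>k. p (v /\<^sub>R 2 ^ k) [^] ((2::nat) ^ k)) (p w) sequentially"
proof -
  define x where "x = (\<lambda>k. p (v /\<^sub>R 2 ^ k))"
  define g where "g = (\<lambda>k. x k [^] ((2::nat) ^ k))"
  have nv: "norm (v /\<^sub>R 2 ^ k) = norm v / 2 ^ k" for k
    by (simp add: divide_inverse)
  have nv_le: "norm (v /\<^sub>R 2 ^ k) \<le> d" for k
  proof -
    have "norm v / 2 ^ k \<le> norm v"
      by (simp add: divide_le_eq mult_le_cancel_left1)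
    then show ?thesis
      using v(2) nv by simp
  qed
  have x: "x k \<in> U" "\<psi> (x k) = v /\<^sub>R 2 ^ k" "x k \<in> carrier G" for k
  proof -
    have "v /\<^sub>R 2 ^ k \<in> V" "norm (v /\<^sub>R 2 ^ k) \<le> r"
      using v(1) subspace_V nv_le[of k] d_bounds by (auto intro: subspace_scale)
    then show "x k \<in> U" "\<psi> (x k) = v /\<^sub>R 2 ^ k" "x k \<in> carrier G"
      unfolding x_def by (auto intro: p_ball)
  qed
  have g: "g k \<in> U" "norm (\<psi> (g k)) \<le> 2 * norm v" for k
  proof -
    have eq: "2 ^ k * norm (\<psi> (x k)) = norm v"
      by (simp add: x(2) nv del: norm_scaleR)
    have "norm v \<le> 2 * d"
      using v(2) d_bounds(1) by linarith
    then show "g k \<in> U" "norm (\<psi> (g k)) \<le> 2 * norm v"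
      using pow_two_le[of "x k" k, OF x(1)] unfolding g_def eq by blast+
  qed
  have step: "norm (\<psi> (g (Suc k)) - \<psi> (g k)) \<le> 2 * C * (norm v)\<^sup>2 / 2 ^ k" for k
  proof -
    define y where "y = x (Suc k) \<otimes> x (Suc k)"
    define z where "z = y \<otimes> inv (x k)"
    let ?s = "norm v / 2 ^ Suc k"
    have s: "norm (\<psi> (x (Suc k))) = ?s" "?s \<le> d"
      using x(2) nv nv_le[of "Suc k"] by metis+
    then have "norm (\<psi> (x (Suc k))) \<le> r"
      using d_bounds by linarith
    then have y: "y \<in> U" "norm (\<psi> y - \<psi> (x (Suc k)) - \<psi> (x (Suc k))) \<le> C * ?s * ?s"
      using mult_bound[of "x (Suc k)" "x (Suc k)"] x s by (simp_all add: y_def)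
    have "\<psi> (x (Suc k)) + \<psi> (x (Suc k)) = \<psi> (x k)"
      by (simp add: x scaleR_add_left[symmetric] field_simps)
    then have yx: "norm (\<psi> y - \<psi> (x k)) \<le> C * ?s * ?s"
      using y(2) by (simp add: diff_diff_eq)
    have xk: "norm (\<psi> (x k)) \<le> 2 * d"
      using nv_le[of k] x(2) d_bounds by auto
    have Cs: "C * ?s \<le> 1 / 32"
      using mult_left_mono[OF s(2), of C] C_mult_d C_pos by linarith
    have "norm (\<psi> y) \<le> norm (\<psi> (x k)) + C * ?s * ?s"
      using yx norm_triangle_ineq2[of "\<psi> y" "\<psi> (x k)"] by linarith
    also have "C * ?s * ?s \<le> 1 / 32 * d"
      using Cs s(2) by (intro mult_mono) (use d_bounds in auto)
    finally have "norm (\<psi> y) \<le> 2 * d"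
      using nv_le[of k] x(2) d_bounds by auto
    then have z: "z \<in> U" "norm (\<psi> z) \<le> 2 * (C * ?s * ?s)"
      using quotient_le[OF y(1) x(1)] xk yx unfolding z_def by force+
    have half: "2 ^ k * ?s = norm v / 2" by simp
    have "2 ^ k * norm (\<psi> z) \<le> 2 ^ k * (2 * (C * ?s * ?s))"
      using z(2) by (intro mult_left_mono) auto
    also have "\<dots> = C * ?s * norm v"
      using half by (simp add: algebra_simps)
    finally have zk: "2 ^ k * norm (\<psi> z) \<le> C * ?s * norm v" .
    have Csv: "C * ?s * norm v \<le> 1 / 32 * d"
      using Cs v(2) by (intro mult_mono) auto
    have zd: "2 ^ k * norm (\<psi> z) \<le> 2 * d"
      using zk Csv d_bounds(1) by linarith
    define q where "q = z [^] ((2::nat) ^ k)"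
    have q: "q \<in> U" "norm (\<psi> q) \<le> 2 * (C * ?s * norm v)"
      using pow_two_le[OF z(1) zd] zk unfolding q_def by auto
    have carr: "y \<in> carrier G" "z \<in> carrier G"
      using y z U_carrier by auto
    have "y = x k \<otimes> z"
      using carr x(3)[of k] by (simp add: z_def m_lcomm)
    moreover have "g (Suc k) = y [^] ((2::nat) ^ k)"
      using x(3) by (simp add: g_def y_def nat_pow_distrib nat_pow_mult mult_2)
    \<comment> \<open>Commutativity enters here: the power of \<open>x k \<otimes> z\<close> splits
      into the product of the powers.\<close>
    ultimately have "g (Suc k) = g k \<otimes> q"
      using carr x(3) by (simp add: g_def q_def nat_pow_distrib)
    moreover have "norm (\<psi> (g k)) \<le> 2 * d" "2 * d \<le> r"
      using g(2)[of k] v(2) d_bounds by auto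
    moreover have "norm (\<psi> q) \<le> r"
      using q(2) Csv d_bounds(1,2) by linarith
    ultimately have "norm (\<psi> (g (Suc k)) - \<psi> (g k) - \<psi> q) \<le> C * norm (\<psi> (g k)) * norm (\<psi> q)"
      using mult_bound[of "g k" q] g q by simp
    also have "\<dots> \<le> 1 * norm (\<psi> q)"
    proof (rule mult_right_mono)
      have "norm (\<psi> (g k)) \<le> 1 / (16 * C)"
        using g(2)[of k] v(2) d_bounds by (simp add: field_simps)
      from mult_left_mono[OF this, of C] show "C * norm (\<psi> (g k)) \<le> 1"
        using C_pos by simp
    qed auto
    finally have "norm (\<psi> (g (Suc k)) - \<psi> (g k)) \<le> 2 * norm (\<psi> q)"
      using norm_triangle_ineq2[of "\<psi> (g (Suc k)) - \<psi> (g k)" "\<psi> q"] by linarith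
    also have "\<dots> \<le> 2 * (2 * (C * ?s * norm v))"
      using q(2) by simp
    also have "\<dots> = 2 * C * (norm v)\<^sup>2 / 2 ^ k"
      by (simp add: power2_eq_square)
    finally show ?thesis .
  qed
  obtain w where w: "(\<lambda>k. \<psi> (g k)) \<longlonglongrightarrow> w" "norm (w - \<psi> (g 0)) \<le> 2 * (2 * C * (norm v)\<^sup>2)"
    using geometric_steps_converge[of "\<lambda>k. \<psi> (g k)", OF step] .
  have "g 0 = x 0"
    using x(3) by (simp add: g_def)
  then have g0: "\<psi> (g 0) = v"
    using x(2)[of 0] by simp
  have wV: "w \<in> V"
    using closed_sequentially[OF closed_subspace[OF subspace_V] _ w(1)] g \<psi>_V by blast
  have nw: "norm w \<le> 2 * norm v"
    by (rule LIMSEQ_le_const2[OF tendsto_norm[OF w(1)]]) (use g in auto)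
  have "w \<in> \<psi> ` U"
    using ball_image nw v(2) d_bounds wV by auto
  then have "limitin X g (p w) sequentially"
    using limitin_chart[OF _ w(1)] g by simp
  then show thesis
    using that[OF wV nw] w(2) g0 by (simp add: g_def x_def)
qed

text \<open>For large \<open>v\<close> the first few vectors \<open>v /\<^sub>R 2 ^ k\<close> may
  lie outside the chart, where \<open>p\<close> is arbitrary; the limit ignores these terms. It is
  unique because the topology is Hausdorff.\<close>

definition E :: "'e \<Rightarrow> 'a" where
  "E v = (THE l. limitin X (\<lambda>k. p (v /\<^sub>R 2 ^ k) [^] ((2::nat) ^ k)) l sequentially)"

lemma E_eqI: "limitin X (\<lambda>k. p (v /\<^sub>R 2 ^ k) [^] ((2::nat) ^ k)) l sequentially \<Longrightarrow> E v = l"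
  unfolding E_def
  by (rule the_equality) (auto intro: limitin_Hausdorff_unique[OF _ _ _ Hausdorff_X])

lemma scaled_small: "\<exists>N. \<forall>k\<ge>N. norm (v /\<^sub>R 2 ^ k) \<le> d"
  using eventually_divide_power_two_le[OF d_bounds(1), of "norm v"] by (simp add: divide_inverse mult.commute)

text \<open>The linear bound yields continuity of \<open>E\<close> at 0; the quadratic one makes its
  kernel discrete.\<close>

lemma E_small:
  assumes "v \<in> V" "norm v \<le> d"
  shows "E v \<in> U" "norm (\<psi> (E v)) \<le> 2 * norm v" "norm (\<psi> (E v) - v) \<le> 4 * C * (norm v)\<^sup>2"
proof -
  obtain w where w: "w \<in> V" "norm w \<le> 2 * norm v" "norm (w - v) \<le> 4 * C * (norm v)\<^sup>2"
    "limitin X (\<lambda>k. p (v /\<^sub>R 2 ^ k) [^] ((2::nat) ^ k)) (p w) sequentially"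
    using dyadic_powers_converge[OF assms] .
  have "E v = p w"
    by (rule E_eqI[OF w(4)])
  moreover have "norm w \<le> r"
    using w(2) assms d_bounds by linarith
  ultimately show "E v \<in> U" "norm (\<psi> (E v)) \<le> 2 * norm v" "norm (\<psi> (E v) - v) \<le> 4 * C * (norm v)\<^sup>2"
    using w p_ball by auto
qed

text \<open>A large \<open>v\<close> is first scaled down to \<open>u = v /\<^sub>R 2 ^ N\<close>,
  where the limit exists. Raising to the fixed power \<open>2 ^ N\<close> is continuous and turns
  the sequence of \<open>u\<close> into a shift of the sequence of \<open>v\<close>.\<close>

lemma limitin_E:
  assumes v: "v \<in> V"
  shows "limitin X (\<lambda>k. p (v /\<^sub>R 2 ^ k) [^] ((2::nat) ^ k)) (E v) sequentially"
proof -
  obtain N where N: "\<And>k. k \<ge> N \<Longrightarrow> norm (v /\<^sub>R 2 ^ k) \<le> d"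
    using scaled_small by blast
  define u where "u = v /\<^sub>R 2 ^ N"
  have u: "u \<in> V" "norm u \<le> d"
    using v N[of N] subspace_V by (auto simp: u_def intro: subspace_scale)
  obtain l where l: "limitin X (\<lambda>k. p (u /\<^sub>R 2 ^ k) [^] ((2::nat) ^ k)) l sequentially"
    using dyadic_powers_converge[OF u] by metis
  have "(p (u /\<^sub>R 2 ^ k) [^] ((2::nat) ^ k)) [^] ((2::nat) ^ N) = p (v /\<^sub>R 2 ^ (k + N)) [^] ((2::nat) ^ (k + N))" for k
  proof -
    have eq: "u /\<^sub>R 2 ^ k = v /\<^sub>R 2 ^ (k + N)"
      by (simp add: u_def power_add)
    have "v /\<^sub>R 2 ^ (k + N) \<in> V" "norm (v /\<^sub>R 2 ^ (k + N)) \<le> r"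
      using v N[of "k + N"] subspace_V d_bounds by (auto intro: subspace_scale)
    then show ?thesis
      using p_ball(3) by (simp add: eq nat_pow_pow power_add)
  qed
  then have "limitin X (\<lambda>k. p (v /\<^sub>R 2 ^ (k + N)) [^] ((2::nat) ^ (k + N))) (l [^] ((2::nat) ^ N)) sequentially"
    using limitin_pow[OF l, of "2 ^ N"] by simp
  then have "limitin X (\<lambda>k. p (v /\<^sub>R 2 ^ k) [^] ((2::nat) ^ k)) (l [^] ((2::nat) ^ N)) sequentially"
    by (rule limitin_sequentially_offset_rev)
  then show ?thesis
    using E_eqI by metis
qed

lemma E_carrier: "v \<in> V \<Longrightarrow> E v \<in> carrier G"
  using limitin_topspace[OF limitin_E] topspace_X by blast

text \<open>At level \<open>k\<close> the defect \<open>q k\<close> of additivity is of order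
  \<open>1 / 4 ^ k\<close>. Its power with exponent \<open>2 ^ k\<close> is therefore of order
  \<open>1 / 2 ^ k\<close> and tends to \<open>\<one>\<close>, while commutativity splits the powers
  of the products.\<close>

lemma E_add:
  assumes v: "v \<in> V" and w: "w \<in> V"
  shows "E (v + w) = E v \<otimes> E w"
proof -
  have vw: "v + w \<in> V"
    using assms subspace_V by (auto intro: subspace_add)
  define P where "P = (\<lambda>u k. p (u /\<^sub>R 2 ^ k))"
  define q where "q = (\<lambda>k. P (v + w) k \<otimes> inv (P v k \<otimes> P w k))"
  obtain N1 where N1: "\<And>k. k \<ge> N1 \<Longrightarrow> norm (v /\<^sub>R 2 ^ k) \<le> d"
    using scaled_small by blast
  obtain N2 where N2: "\<And>k. k \<ge> N2 \<Longrightarrow> norm (w /\<^sub>R 2 ^ k) \<le> d"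
    using scaled_small by blast
  obtain N3 where N3: "\<And>k. k \<ge> N3 \<Longrightarrow> norm ((v + w) /\<^sub>R 2 ^ k) \<le> d"
    using scaled_small by blast
  obtain N5 where N5: "\<And>k. k \<ge> N5 \<Longrightarrow> 2 * C * norm v * norm w / 2 ^ k \<le> 2 * d"
    using eventually_divide_power_two_le[of "2 * d"] d_bounds(1) by auto
  define N where "N = N1 + N2 + N3 + N5"
  have P: "P u k \<in> U" "\<psi> (P u k) = u /\<^sub>R 2 ^ k" "P u k \<in> carrier G"
      "norm (\<psi> (P u k)) \<le> d"
    if "u = v \<or> u = w \<or> u = v + w" "k \<ge> N" for u k
  proof -
    have small: "norm (u /\<^sub>R 2 ^ k) \<le> d"
      using that N1[of k] N2[of k] N3[of k] unfolding N_def by auto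
    then have "u /\<^sub>R 2 ^ k \<in> V" "norm (u /\<^sub>R 2 ^ k) \<le> r"
      using that v w vw subspace_V d_bounds by (auto intro: subspace_scale)
    then show "P u k \<in> U" "\<psi> (P u k) = u /\<^sub>R 2 ^ k" "P u k \<in> carrier G" "norm (\<psi> (P u k)) \<le> d"
      unfolding P_def using p_ball small by auto
  qed
  have q: "q k [^] ((2::nat) ^ k) \<in> U \<and> norm (\<psi> (q k [^] ((2::nat) ^ k))) \<le> 4 * C * norm v * norm w / 2 ^ k \<and>
      P (v + w) k [^] ((2::nat) ^ k) = q k [^] ((2::nat) ^ k) \<otimes> (P v k [^] ((2::nat) ^ k) \<otimes> P w k [^] ((2::nat) ^ k))"
    if k: "k \<ge> N" for k
  proof -
    define y where "y = P v k \<otimes> P w k"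
    have b: "norm (\<psi> (P v k)) \<le> r" "norm (\<psi> (P w k)) \<le> r"
      using P(4)[of v, OF _ k] P(4)[of w, OF _ k] d_bounds by auto
    have y: "y \<in> U" "norm (\<psi> y - \<psi> (P v k) - \<psi> (P w k)) \<le> C * norm (\<psi> (P v k)) * norm (\<psi> (P w k))"
      using mult_bound[OF P(1)[of v, OF _ k] P(1)[of w, OF _ k] b] by (auto simp: y_def)
    have diff: "norm (\<psi> y - \<psi> (P (v + w) k)) \<le> C * (norm v / 2 ^ k) * (norm w / 2 ^ k)"
      using y(2) k by (simp add: P(2) scaleR_add_right diff_diff_eq divide_inverse mult.commute)
    have yd: "norm (\<psi> y) \<le> 2 * d"
    proof -
      have "norm (\<psi> y - \<psi> (P (v + w) k)) \<le> C * norm (\<psi> (P v k)) * norm (\<psi> (P w k))"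
        using y(2) k by (simp add: P(2) scaleR_add_right diff_diff_eq)
      also have "\<dots> \<le> C * d * d"
        using P(4)[of v, OF _ k] P(4)[of w, OF _ k] C_pos d_bounds(1) by (intro mult_mono) auto
      also have "\<dots> \<le> 1 * d"
        using d_bounds C_pos by (intro mult_right_mono) (auto simp: field_simps)
      finally show ?thesis
        using P(4)[of "v + w", OF _ k] norm_triangle_ineq2[of "\<psi> y" "\<psi> (P (v + w) k)"] by auto
    qed
    have z: "q k \<in> U" "norm (\<psi> (q k)) \<le> 2 * (C * (norm v / 2 ^ k) * (norm w / 2 ^ k))"
      using quotient_le[OF P(1)[of "v + w", OF _ k] y(1) _ yd] P(4)[of "v + w", OF _ k] d_bounds(1) diff
      unfolding q_def y_def[symmetric] by (auto simp: norm_minus_commute)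
    have "2 ^ k * norm (\<psi> (q k)) \<le> 2 ^ k * (2 * (C * (norm v / 2 ^ k) * (norm w / 2 ^ k)))"
      using z(2) by (intro mult_left_mono) auto
    then have zk: "2 ^ k * norm (\<psi> (q k)) \<le> 2 * C * norm v * norm w / 2 ^ k"
      by simp
    have carr: "P v k \<in> carrier G" "P w k \<in> carrier G" "P (v + w) k \<in> carrier G" "q k \<in> carrier G"
      using P(3) k z U_carrier by auto
    have "P (v + w) k = q k \<otimes> (P v k \<otimes> P w k)"
      using carr by (simp add: q_def m_assoc)
    then have "P (v + w) k [^] ((2::nat) ^ k) = q k [^] ((2::nat) ^ k) \<otimes> (P v k [^] ((2::nat) ^ k) \<otimes> P w k [^] ((2::nat) ^ k))"
      using carr by (simp add: nat_pow_distrib)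
    moreover have "2 ^ k * norm (\<psi> (q k)) \<le> 2 * d"
      using zk N5[of k] k unfolding N_def by linarith
    ultimately show ?thesis
      using pow_two_le[OF z(1)] zk by force
  qed
  have "limitin X (\<lambda>k. q k [^] ((2::nat) ^ k)) \<one> sequentially"
  proof (rule limitin_one)
    show "\<forall>\<^sub>F k in sequentially. q k [^] ((2::nat) ^ k) \<in> U"
      using q eventually_sequentially by auto
    show "(\<lambda>k. \<psi> (q k [^] ((2::nat) ^ k))) \<longlonglongrightarrow> 0"
    proof (rule Lim_null_comparison)
      show "\<forall>\<^sub>F k in sequentially. norm (\<psi> (q k [^] ((2::nat) ^ k))) \<le> 4 * C * norm v * norm w / 2 ^ k"
        using q eventually_sequentially by auto
      show "(\<lambda>k. 4 * C * norm v * norm w / 2 ^ k) \<longlonglongrightarrow> 0"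
        by (rule LIMSEQ_divide_realpow_zero) simp
    qed
  qed
  then have "limitin X (\<lambda>k. q k [^] ((2::nat) ^ k) \<otimes> (P v k [^] ((2::nat) ^ k) \<otimes> P w k [^] ((2::nat) ^ k)))
      (\<one> \<otimes> (E v \<otimes> E w)) sequentially"
    using limitin_E v w unfolding P_def by (intro limitin_mult) auto
  then have "limitin X (\<lambda>k. P (v + w) k [^] ((2::nat) ^ k)) (\<one> \<otimes> (E v \<otimes> E w)) sequentially"
    by (rule limitin_transform_eventually[rotated])
      (use q in \<open>auto simp: eventually_sequentially intro!: exI[of _ N]\<close>)
  then show ?thesis
    using E_eqI[of "v + w"] v w E_carrier by (simp add: P_def)
qed

section \<open>The exponential map as an open homomorphism with discrete kernel\<close>

lemma E_zero: "E 0 = \<one>"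
proof -
  have "E 0 \<otimes> E 0 = E 0"
    using E_add[of 0 0] subspace_0[OF subspace_V] by simp
  then show ?thesis
    using E_carrier[OF subspace_0[OF subspace_V]] by simp
qed

lemma E_diff:
  assumes "v \<in> V" "w \<in> V"
  shows "E v = E w \<otimes> E (v - w)"
  using E_add[of w "v - w"] assms subspace_diff[OF subspace_V] by simp

text \<open>If \<open>E v = \<one>\<close>, the quadratic error bound of \<open>E_small\<close>
  reads \<open>norm v \<le> 4 * C * (norm v)\<^sup>2\<close>, and for \<open>norm v \<le> d\<close>
  the right side is at most \<open>norm v / 8\<close>.\<close>

lemma E_kernel_discrete:
  assumes v: "v \<in> V" "norm v \<le> d" and "E v = \<one>"
  shows "v = 0"
proof (rule ccontr)
  assume "v \<noteq> 0"
  have "norm v \<le> 4 * C * (norm v)\<^sup>2"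
    using E_small(3)[OF v] assms(3) \<psi>_one by simp
  also have "\<dots> = (4 * (C * norm v)) * norm v"
    by (simp add: power2_eq_square)
  also have "C * norm v \<le> 1 / 32"
    using mult_left_mono[OF v(2), of C] C_mult_d C_pos by linarith
  then have "(4 * (C * norm v)) * norm v \<le> (4 * (1 / 32)) * norm v"
    by (intro mult_right_mono) auto
  finally show False
    using \<open>v \<noteq> 0\<close> by simp
qed

text \<open>Continuity at 0 comes from \<open>E_small\<close>; additivity and the translations of
  the group carry it to every other point.\<close>

lemma E_continuous: "continuous_map (top_of_set V) X E"
  unfolding continuous_map_def
proof (intro conjI allI impI)
  show "E \<in> topspace (top_of_set V) \<rightarrow> topspace X"
    using E_carrier topspace_X by auto
  fix W assume W: "openin X W"
  show "openin (top_of_set V) {v \<in> topspace (top_of_set V). E v \<in> W}"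
    unfolding openin_contains_ball
  proof (intro conjI ballI)
    fix v assume "v \<in> {v \<in> topspace (top_of_set V). E v \<in> W}"
    then have v: "v \<in> V" "E v \<in> W" by auto
    have c: "E v \<in> carrier G" "inv (E v) \<in> carrier G"
      using v E_carrier by auto
    have "openin X ((\<lambda>x. inv (E v) \<otimes> x) ` W)"
      using openin_translation[OF c(2) W] .
    moreover have "\<one> \<in> (\<lambda>x. inv (E v) \<otimes> x) ` W"
      using v c by (intro image_eqI[of _ _ "E v"]) auto
    ultimately obtain e where e: "e > 0"
      "\<And>x. x \<in> U \<Longrightarrow> norm (\<psi> x) < e \<Longrightarrow> x \<in> (\<lambda>x. inv (E v) \<otimes> x) ` W"
      using chart_ball_subset by metis
    show "\<exists>\<epsilon>>0. ball v \<epsilon> \<inter> V \<subseteq> {v \<in> topspace (top_of_set V). E v \<in> W}"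
    proof (intro exI[of _ "min d (e / 2)"] conjI subsetI)
      show "min d (e / 2) > 0" using d_bounds e by auto
      fix u assume u: "u \<in> ball v (min d (e / 2)) \<inter> V"
      then have "u - v \<in> V" "norm (u - v) < d" "norm (u - v) < e / 2"
        using v subspace_V by (auto simp: dist_norm norm_minus_commute intro: subspace_diff)
      then have "E (u - v) \<in> U" "norm (\<psi> (E (u - v))) < e"
        using E_small[of "u - v"] by auto
      then obtain x where x: "x \<in> W" "E (u - v) = inv (E v) \<otimes> x"
        using e by blast
      have "x \<in> carrier G"
        using x W openin_subset topspace_X by blast
      then have "E u = x"
        using E_diff[of u v] u v c x by (simp add: m_assoc[symmetric])
      then show "u \<in> {v \<in> topspace (top_of_set V). E v \<in> W}"
        using u x by auto
    qed
  qed auto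
qed

text \<open>Two points of a ball of radius at most \<open>d / 2\<close> differ by at most
  \<open>d\<close>, so the discrete kernel makes \<open>E\<close> injective there. In coordinates it
  is then a continuous injection from an open subset of \<open>V\<close> into \<open>V\<close>, to
  which invariance of domain applies.\<close>

lemma E_ball_open:
  assumes e: "0 < e" "e \<le> d / 2"
  shows "openin X (E ` (ball 0 e \<inter> V))"
proof -
  let ?B = "ball 0 e \<inter> V"
  have B: "v \<in> V" "norm v \<le> d" if "v \<in> ?B" for v
    using that e by auto
  have E_B: "E v \<in> U" "\<psi> (E v) \<in> V" if "v \<in> ?B" for v
    using E_small(1)[OF B[OF that]] \<psi>_V by auto
  have "continuous_map (top_of_set ?B) (subtopology X U) E"
    using continuous_map_from_subtopology_mono[OF E_continuous, of ?B] E_B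
    by (auto simp: continuous_map_in_subtopology)
  then have "continuous_map (top_of_set ?B) (top_of_set (\<psi> ` U)) (\<psi> \<circ> E)"
    using continuous_map_compose homeomorphic_imp_continuous_map[OF homeo] by blast
  then have cont: "continuous_on ?B (\<psi> \<circ> E)"
    using continuous_map_into_fulltopology[of "top_of_set ?B"] continuous_map_iff_continuous by (metis continuous_map_in_subtopology)
  have inj: "inj_on (\<psi> \<circ> E) ?B"
  proof (rule inj_onI)
    fix u v assume uv: "u \<in> ?B" "v \<in> ?B" "(\<psi> \<circ> E) u = (\<psi> \<circ> E) v"
    then have eq: "E u = E v"
      using E_B(1) p_\<psi> by (metis comp_apply)
    have "norm (u - v) \<le> norm u + norm v"
      by (rule norm_triangle_ineq4)
    then have small: "u - v \<in> V" "norm (u - v) \<le> d"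
      using uv e subspace_V by (auto intro: subspace_diff)
    have "E (u - v) = \<one>"
      using E_diff[of u v] eq E_carrier[OF B(1)[OF uv(2)]] E_carrier[OF small(1)] uv by simp
    then show "u = v"
      using E_kernel_discrete[OF small] by simp
  qed
  have "openin (top_of_set V) ((\<psi> \<circ> E) ` ?B)"
    by (rule invariance_of_domain_subspaces[OF _ subspace_V subspace_V order_refl cont _ inj])
      (use E_B in \<open>auto simp: openin_open\<close>)
  then have "openin X {x \<in> U. \<psi> x \<in> (\<psi> \<circ> E) ` ?B}"
    by (rule open_chart_preimage)
  moreover have "{x \<in> U. \<psi> x \<in> (\<psi> \<circ> E) ` ?B} = E ` ?B"
    using E_B(1) inj_\<psi> by (auto dest: inj_onD)
  ultimately show ?thesis by simp
qed

lemma E_open: "open_map (top_of_set V) X E"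
  unfolding open_map_def
proof (intro allI impI)
  fix S assume S: "openin (top_of_set V) S"
  have SV: "S \<subseteq> V"
    using S openin_imp_subset by blast
  show "openin X (E ` S)"
    unfolding openin_subopen[of X "E ` S"]
  proof (intro ballI)
    fix x assume "x \<in> E ` S"
    then obtain v where v: "v \<in> S" "x = E v" by blast
    then obtain e where e: "e > 0" "ball v e \<inter> V \<subseteq> S"
      using S unfolding openin_contains_ball by blast
    define e' where "e' = min e (d / 2)"
    have e': "0 < e'" "e' \<le> d / 2" "e' \<le> e"
      using e d_bounds by (auto simp: e'_def)
    have vV: "v \<in> V" using v SV by auto
    have "openin X ((\<lambda>x. E v \<otimes> x) ` E ` (ball 0 e' \<inter> V))"
      using openin_translation[OF E_carrier[OF vV] E_ball_open[OF e'(1,2)]] .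
    moreover have "x \<in> (\<lambda>x. E v \<otimes> x) ` E ` (ball 0 e' \<inter> V)"
      using e'(1) subspace_0[OF subspace_V] v E_zero E_carrier[OF vV] by (auto intro!: image_eqI[of _ _ \<one>] image_eqI[of _ _ 0])
    moreover have "(\<lambda>x. E v \<otimes> x) ` E ` (ball 0 e' \<inter> V) \<subseteq> E ` S"
    proof clarify
      fix u assume u: "u \<in> ball 0 e'" "u \<in> V"
      then have "v + u \<in> ball v e \<inter> V"
        using e'(3) vV subspace_V by (auto simp: dist_norm intro: subspace_add)
      then have "v + u \<in> S"
        using e(2) by blast
      then show "E v \<otimes> E u \<in> E ` S"
        using E_add[OF vV u(2)] by (metis imageI)
    qed
    ultimately show "\<exists>T. openin X T \<and> x \<in> T \<and> T \<subseteq> E ` S"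
      by blast
  qed
qed

text \<open>The image is an open subgroup. Its complement is a union of translates of it, hence open
  as well, so connectedness leaves only the whole group.\<close>

lemma E_surj:
  assumes "connected_space X"
  shows "E ` V = carrier G"
proof -
  have op: "openin X (E ` V)"
    using E_open by (auto simp: open_map_def)
  have "topspace X - E ` V = \<Union> ((\<lambda>g. (\<lambda>x. g \<otimes> x) ` E ` V) ` (topspace X - E ` V))" (is "?L = ?R")
  proof (intro equalityI subsetI)
    fix g assume g: "g \<in> ?L"
    then have "g = g \<otimes> E 0"
      by (simp add: E_zero topspace_X)
    then show "g \<in> ?R"
      using g subspace_0[OF subspace_V] by blast
  next
    fix x assume "x \<in> ?R"
    then obtain g v where g: "g \<in> carrier G" "g \<notin> E ` V" "v \<in> V" "x = g \<otimes> E v"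
      by (auto simp: topspace_X)
    have "E v \<otimes> E (- v) = \<one>"
      using E_add[of v "- v"] E_zero g subspace_neg[OF subspace_V] by simp
    then have "x \<otimes> E (- v) = g"
      using g E_carrier[of v] E_carrier[of "- v"] subspace_neg[OF subspace_V] by (simp add: m_assoc)
    moreover have "E w \<otimes> E (- v) \<in> E ` V" if "w \<in> V" for w
      using E_add[OF that, of "- v"] that g(3) subspace_neg[OF subspace_V] subspace_add[OF subspace_V]
      by (metis imageI)
    ultimately have "x \<notin> E ` V"
      using g(2) by blast
    then show "x \<in> ?L"
      using g E_carrier by (simp add: topspace_X)
  qed
  moreover have "openin X ?R"
    using openin_translation[OF _ op] by (auto simp: topspace_X)
  ultimately have "closedin X (E ` V)"
    using openin_subset[OF op] by (simp add: closedin_def)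
  then have "E ` V = {} \<or> E ` V = topspace X"
    using assms op by (metis connected_space_clopen_in)
  then show ?thesis
    using subspace_0[OF subspace_V] topspace_X by auto
qed

end

section \<open>Quotients of a vector space by a discrete subgroup\<close>

lemma cis_2pi_eq_1_iff: "cis (2 * pi * t) = 1 \<longleftrightarrow> t \<in> \<int>"
proof -
  have eq: "2 * pi * t = of_int (2 * n) * pi \<longleftrightarrow> t = of_int n" for n
    using mult_cancel_left[of "2 * pi" t "of_int n"] by (simp add: mult_ac)
  have "cis (2 * pi * t) = 1 \<longleftrightarrow> (\<exists>n::int. 2 * pi * t = of_int (2 * n) * pi)"
    by (simp add: cis_conv_exp exp_eq_1)
  also have "\<dots> \<longleftrightarrow> (\<exists>n::int. t = of_int n)"
    by (simp only: eq)
  finally show ?thesis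
    by (auto simp: Ints_def)
qed

text \<open>An infinite bounded set has a limit point \<open>l\<close>, and two distinct members
  within \<open>e / 2\<close> of \<open>l\<close> are less than \<open>e\<close> apart.\<close>

lemma finite_uniformly_discrete_bounded:
  fixes S :: "'e::euclidean_space set"
  assumes "bounded S" and "e > 0" and disc: "\<And>x y. x \<in> S \<Longrightarrow> y \<in> S \<Longrightarrow> dist x y < e \<Longrightarrow> x = y"
  shows "finite S"
proof (rule ccontr)
  assume "infinite S"
  moreover have "compact (closure S)"
    using assms(1) compact_closure by blast
  ultimately obtain l where l: "l islimpt S"
    using Heine_Borel_imp_Bolzano_Weierstrass closure_subset by metis
  then obtain x where x: "x \<in> S" "x \<noteq> l" "dist x l < e / 2"
    using \<open>e > 0\<close> unfolding islimpt_approachable by (meson half_gt_zero)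
  \<comment> \<open>Being strictly closer to \<open>l\<close> than \<open>x\<close> is makes
    \<open>y\<close> different from \<open>x\<close>.\<close>
  then obtain y where y: "y \<in> S" "y \<noteq> l" "dist y l < min (e / 2) (dist x l)"
    using \<open>e > 0\<close> l unfolding islimpt_approachable by (meson min_less_iff_conj half_gt_zero zero_less_dist_iff)
  have "dist x y \<le> dist x l + dist y l"
    by (rule dist_triangle2)
  then have "x = y"
    using x y by (intro disc) auto
  then show False
    using y by simp
qed

text \<open>The outcome of the exponential construction, detached from the chart: the group is the
  quotient of \<open>V\<close> by a discrete subgroup. The study of orbits starts from this
  alone.\<close>

locale vector_cover = comm_topological_group +
  fixes V :: "'e::euclidean_space set" and E :: "'e \<Rightarrow> 'a" and \<delta> :: real
  assumes subspace_V: "subspace V"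
    and E_continuous: "continuous_map (top_of_set V) X E"
    and E_open: "open_map (top_of_set V) X E"
    and E_surj: "E ` V = carrier G"
    and E_add: "\<And>v w. v \<in> V \<Longrightarrow> w \<in> V \<Longrightarrow> E (v + w) = E v \<otimes> E w"
    and \<delta>_pos: "\<delta> > 0"
    and E_kernel_discrete: "\<And>v. v \<in> V \<Longrightarrow> norm v < \<delta> \<Longrightarrow> E v = \<one> \<Longrightarrow> v = 0"
begin

section \<open>The kernel and the quotient map\<close>

definition \<Gamma> :: "'e set" where "\<Gamma> = {v \<in> V. E v = \<one>}"

lemma E_carrier: "v \<in> V \<Longrightarrow> E v \<in> carrier G"
  using E_surj by blast

lemma E_zero: "E 0 = \<one>"
proof -
  have "E 0 \<otimes> E 0 = E 0"
    using E_add[of 0 0] subspace_0[OF subspace_V] by simp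
  then show ?thesis
    using E_carrier[OF subspace_0[OF subspace_V]] by simp
qed

lemma E_eq_iff:
  assumes "v \<in> V" "w \<in> V"
  shows "E v = E w \<longleftrightarrow> v - w \<in> \<Gamma>"
proof -
  have vw: "v - w \<in> V"
    using assms subspace_diff[OF subspace_V] by blast
  have "E v = E w \<otimes> E (v - w)"
    using E_add[OF assms(2) vw] by simp
  then show ?thesis
    using E_carrier[OF assms(2)] E_carrier[OF vw] vw by (simp add: \<Gamma>_def)
qed

lemma \<Gamma>_V: "v \<in> \<Gamma> \<Longrightarrow> v \<in> V"
  by (simp add: \<Gamma>_def)

lemma \<Gamma>_zero: "0 \<in> \<Gamma>"
  using E_zero subspace_0[OF subspace_V] by (simp add: \<Gamma>_def)

lemma \<Gamma>_add: "v \<in> \<Gamma> \<Longrightarrow> w \<in> \<Gamma> \<Longrightarrow> v + w \<in> \<Gamma>"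
  using E_add subspace_add[OF subspace_V] by (simp add: \<Gamma>_def)

lemma \<Gamma>_diff: "v \<in> \<Gamma> \<Longrightarrow> w \<in> \<Gamma> \<Longrightarrow> v - w \<in> \<Gamma>"
  using E_eq_iff[of v w] by (simp add: \<Gamma>_def)

lemma \<Gamma>_int: "v \<in> \<Gamma> \<Longrightarrow> of_int k *\<^sub>R v \<in> \<Gamma>"
proof (induction k rule: int_induct[of _ 0])
  case base
  then show ?case using \<Gamma>_zero by simp
next
  case (step1 i)
  then show ?case using \<Gamma>_add[of "of_int i *\<^sub>R v" v] by (simp add: algebra_simps)
next
  case (step2 i)
  then show ?case using \<Gamma>_diff[of "of_int i *\<^sub>R v" v] by (simp add: algebra_simps)
qed

lemma \<Gamma>_sum: "(\<And>b. b \<in> B \<Longrightarrow> f b \<in> \<Gamma>) \<Longrightarrow> sum f B \<in> \<Gamma>"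
  by (induction B rule: infinite_finite_induct) (auto intro: \<Gamma>_zero \<Gamma>_add)

lemma finite_\<Gamma>_cball: "finite (\<Gamma> \<inter> cball 0 R)"
proof (rule finite_uniformly_discrete_bounded[OF _ \<delta>_pos])
  show "x = y" if "x \<in> \<Gamma> \<inter> cball 0 R" "y \<in> \<Gamma> \<inter> cball 0 R" "dist x y < \<delta>" for x y
    using \<Gamma>_diff[of x y] that E_kernel_discrete[of "x - y"] by (auto simp: \<Gamma>_def dist_norm)
qed (simp add: bounded_Int)

lemma E_quotient: "quotient_map (top_of_set V) X E"
  using continuous_open_imp_quotient_map[OF E_continuous E_open] E_surj topspace_X by simp

text \<open>Continuity of maps defined on the group is checked on \<open>V\<close>, since
  \<open>E\<close> is a quotient map.\<close>

lemma continuous_descends: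
  assumes "continuous_map (top_of_set V) Y f" and "\<And>v. v \<in> V \<Longrightarrow> h (E v) = f v"
  shows "continuous_map X Y h"
proof (rule continuous_compose_quotient_map[OF E_quotient])
  show "continuous_map (top_of_set V) Y (h \<circ> E)"
    using continuous_map_eq[OF assms(1), of "h \<circ> E"] assms(2) by simp
qed

text \<open>A choice of representatives that need not be continuous; it matters only modulo
  \<open>\<Gamma>\<close>.\<close>

definition section_E :: "'a \<Rightarrow> 'e" where "section_E = inv_into V E"

lemma section_E: "v \<in> V \<Longrightarrow> section_E (E v) \<in> V" "v \<in> V \<Longrightarrow> E (section_E (E v)) = E v"
  "v \<in> V \<Longrightarrow> section_E (E v) - v \<in> \<Gamma>"
proof -
  assume v: "v \<in> V"
  then show *: "section_E (E v) \<in> V" "E (section_E (E v)) = E v"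
    by (auto simp: section_E_def inv_into_into f_inv_into_f)
  show "section_E (E v) - v \<in> \<Gamma>"
    using E_eq_iff[OF *(1) v] *(2) by blast
qed

section \<open>Automorphisms induced by linear maps\<close>

lemma carrier_continuous_Aut:
  "\<alpha> \<in> carrier (continuous_Aut G X) \<longleftrightarrow>
     \<alpha> \<in> hom G G \<and> \<alpha> \<in> extensional (carrier G) \<and> bij_betw \<alpha> (carrier G) (carrier G) \<and> continuous_map X X \<alpha>"
  by (auto simp: continuous_Aut_def auto_def Bij_def)

text \<open>Because \<open>L\<close> preserves \<open>\<Gamma>\<close>, the value
  \<open>E (L v)\<close> depends only on \<open>E v\<close>; because \<open>L'\<close> does, the
  induced map is injective. The second condition has content: doubling preserves the integers, but
  it is not injective on the reals modulo the integers.\<close>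

lemma induced_automorphism:
  assumes lin: "linear L"
    and LV: "\<And>v. v \<in> V \<Longrightarrow> L v \<in> V" and L'V: "\<And>v. v \<in> V \<Longrightarrow> L' v \<in> V"
    and L'L: "\<And>v. v \<in> V \<Longrightarrow> L' (L v) = v" and LL': "\<And>v. v \<in> V \<Longrightarrow> L (L' v) = v"
    and L\<Gamma>: "\<And>v. v \<in> \<Gamma> \<Longrightarrow> L v \<in> \<Gamma>" and L'\<Gamma>: "\<And>v. v \<in> \<Gamma> \<Longrightarrow> L' v \<in> \<Gamma>"
  obtains \<alpha> where "\<alpha> \<in> carrier (continuous_Aut G X)" "\<And>v. v \<in> V \<Longrightarrow> \<alpha> (E v) = E (L v)"
proof -
  define \<alpha> where "\<alpha> = (\<lambda>g\<in>carrier G. E (L (section_E g)))"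
  have \<alpha>E: "\<alpha> (E v) = E (L v)" if v: "v \<in> V" for v
  proof -
    have "L (section_E (E v)) - L v \<in> \<Gamma>"
      using L\<Gamma>[OF section_E(3)[OF v]] by (simp add: linear_diff[OF lin])
    then show ?thesis
      using E_eq_iff[OF LV[OF section_E(1)[OF v]] LV[OF v]] E_carrier[OF v] by (simp add: \<alpha>_def)
  qed
  have surj: "\<exists>v\<in>V. g = E v" if "g \<in> carrier G" for g
    using that E_surj by blast
  have "\<alpha> \<in> hom G G"
  proof (rule homI)
    show "\<alpha> g \<in> carrier G" if "g \<in> carrier G" for g
      using surj[OF that] \<alpha>E LV E_carrier by auto
    show "\<alpha> (g \<otimes> h) = \<alpha> g \<otimes> \<alpha> h" if gh: "g \<in> carrier G" "h \<in> carrier G" for g h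
    proof -
      obtain v w where vw: "v \<in> V" "w \<in> V" "g = E v" "h = E w"
        using surj gh by metis
      have "\<alpha> (g \<otimes> h) = E (L (v + w))"
        using vw E_add[of v w] \<alpha>E[of "v + w"] subspace_add[OF subspace_V] by simp
      then show ?thesis
        using vw \<alpha>E LV E_add[of "L v" "L w"] by (simp add: linear_add[OF lin])
    qed
  qed
  moreover have "bij_betw \<alpha> (carrier G) (carrier G)"
    unfolding bij_betw_def
  proof
    show "inj_on \<alpha> (carrier G)"
    proof (rule inj_onI)
      fix g h assume gh: "g \<in> carrier G" "h \<in> carrier G" "\<alpha> g = \<alpha> h"
      then obtain v w where vw: "v \<in> V" "w \<in> V" "g = E v" "h = E w"
        using surj by metis
      then have "L (v - w) \<in> \<Gamma>"
        using gh(3) \<alpha>E E_eq_iff LV by (simp add: linear_diff[OF lin])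
      then have "v - w \<in> \<Gamma>"
        using L'\<Gamma> L'L[of "v - w"] vw subspace_diff[OF subspace_V] by fastforce
      then show "g = h"
        using E_eq_iff vw by simp
    qed
    show "\<alpha> ` carrier G = carrier G"
    proof
      show "\<alpha> ` carrier G \<subseteq> carrier G"
        using surj \<alpha>E LV E_carrier by (metis image_subsetI)
      show "carrier G \<subseteq> \<alpha> ` carrier G"
      proof
        fix g assume "g \<in> carrier G"
        then obtain v where v: "v \<in> V" "g = E v"
          using surj by blast
        then have "g = \<alpha> (E (L' v))"
          using \<alpha>E[OF L'V] LL' by simp
        then show "g \<in> \<alpha> ` carrier G"
          using E_carrier[OF L'V] v by blast
      qed
    qed
  qed
  moreover have "continuous_map X X \<alpha>"
  proof (rule continuous_descends)
    have "continuous_map (top_of_set V) (top_of_set V) L"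
      using LV linear_continuous_on[OF linear_conv_bounded_linear[THEN iffD1, OF lin]] by auto
    from continuous_map_compose[OF this E_continuous]
    show "continuous_map (top_of_set V) X (\<lambda>v. E (L v))"
      by (simp add: o_def)
  qed (rule \<alpha>E)
  ultimately have "\<alpha> \<in> carrier (continuous_Aut G X)"
    by (auto simp: carrier_continuous_Aut \<alpha>_def)
  then show thesis
    using that \<alpha>E by blast
qed

section \<open>Orbit closures lifted to the vector space\<close>

text \<open>The lift to \<open>V\<close> is closed in \<open>V\<close>, periodic under
  \<open>\<Gamma>\<close> and invariant under lifts of automorphisms, so points can be added to it
  by vector arithmetic.\<close>

definition orbit_closure :: "'e \<Rightarrow> 'e set" where
  "orbit_closure v = {w \<in> V. E w \<in> X closure_of (orbit (continuous_Aut G X) (\<lambda>\<alpha>. \<alpha>) (E v))}"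

lemma orbit_subset: "v \<in> V \<Longrightarrow> orbit (continuous_Aut G X) (\<lambda>\<alpha>. \<alpha>) (E v) \<subseteq> topspace X"
  using E_carrier by (auto simp: orbit_def carrier_continuous_Aut hom_def topspace_X)

lemma orbit_in_orbit_closure:
  assumes "\<alpha> \<in> carrier (continuous_Aut G X)" "v \<in> V" "w \<in> V" "\<alpha> (E v) = E w"
  shows "w \<in> orbit_closure v"
proof -
  have "E w \<in> orbit (continuous_Aut G X) (\<lambda>\<alpha>. \<alpha>) (E v)"
    unfolding orbit_def using assms by (intro CollectI exI[of _ \<alpha>]) simp
  then show ?thesis
    unfolding orbit_closure_def using closure_of_subset[OF orbit_subset[OF assms(2)]] assms(3) by blast
qed

lemma orbit_closure_refl:
  assumes "v \<in> V"
  shows "v \<in> orbit_closure v"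
proof -
  obtain \<alpha> where "\<alpha> \<in> carrier (continuous_Aut G X)" "\<And>v. v \<in> V \<Longrightarrow> \<alpha> (E v) = E v"
    by (rule induced_automorphism[of "\<lambda>v. v" "\<lambda>v. v"]) (auto simp: linear_ident)
  then show ?thesis
    using orbit_in_orbit_closure assms by blast
qed

lemma orbit_closure_closed:
  assumes "w \<in> V" "w \<in> closure (orbit_closure v)"
  shows "w \<in> orbit_closure v"
proof -
  let ?C = "X closure_of (orbit (continuous_Aut G X) (\<lambda>\<alpha>. \<alpha>) (E v))"
  have "w \<in> top_of_set V closure_of (orbit_closure v)"
    using assms by (simp add: closure_of_subtopology orbit_closure_def Collect_conj_eq Int_absorb1)
  then have "E w \<in> X closure_of (E ` orbit_closure v)"
    using continuous_map_image_closure_subset[OF E_continuous] by blast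
  also have "\<dots> \<subseteq> X closure_of ?C"
    by (rule closure_of_mono) (auto simp: orbit_closure_def)
  finally show ?thesis
    using assms(1) by (simp add: orbit_closure_def)
qed

lemma orbit_closure_\<Gamma>:
  assumes "w \<in> orbit_closure v" "\<gamma> \<in> \<Gamma>"
  shows "w + \<gamma> \<in> orbit_closure v"
proof -
  have "w \<in> V" using assms(1) by (simp add: orbit_closure_def)
  then have "w + \<gamma> \<in> V" "E (w + \<gamma>) = E w"
    using E_eq_iff[of "w + \<gamma>" w] assms(2) \<Gamma>_V subspace_add[OF subspace_V] by auto
  then show ?thesis
    using assms(1) by (simp add: orbit_closure_def)
qed

text \<open>An automorphism maps the orbit into itself and, being continuous, also its closure.
  Points already reached as limits can therefore be moved again.\<close>

lemma orbit_closure_automorphism: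
  assumes v: "v \<in> V" and w: "w \<in> orbit_closure v" and w': "w' \<in> V"
    and \<alpha>: "\<alpha> \<in> carrier (continuous_Aut G X)" "\<alpha> (E w) = E w'"
  shows "w' \<in> orbit_closure v"
proof -
  let ?O = "orbit (continuous_Aut G X) (\<lambda>\<alpha>. \<alpha>) (E v)"
  have "\<alpha> ` ?O \<subseteq> ?O"
  proof clarify
    fix g assume "g \<in> ?O"
    then obtain \<beta> where \<beta>: "\<beta> \<in> carrier (continuous_Aut G X)" "g = \<beta> (E v)"
      by (auto simp: orbit_def)
    have "compose (carrier G) \<alpha> \<beta> \<in> hom G G"
      using \<alpha> \<beta> hom_compose unfolding carrier_continuous_Aut by blast
    moreover have "bij_betw (compose (carrier G) \<alpha> \<beta>) (carrier G) (carrier G)"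
      using \<alpha> \<beta> bij_betw_compose unfolding carrier_continuous_Aut by blast
    moreover have "continuous_map X X (compose (carrier G) \<alpha> \<beta>)"
      by (rule continuous_map_eq[OF continuous_map_compose[of X X \<beta> X \<alpha>]])
        (use \<alpha> \<beta> in \<open>auto simp: carrier_continuous_Aut compose_def topspace_X\<close>)
    ultimately have "compose (carrier G) \<alpha> \<beta> \<in> carrier (continuous_Aut G X)"
      by (simp add: carrier_continuous_Aut)
    moreover have "compose (carrier G) \<alpha> \<beta> (E v) = \<alpha> g"
      using \<beta> E_carrier[OF v] by (simp add: compose_def)
    ultimately show "\<alpha> g \<in> ?O"
      unfolding orbit_def by (intro CollectI exI[of _ "compose (carrier G) \<alpha> \<beta>"]) simp
  qed
  then have "\<alpha> ` (X closure_of ?O) \<subseteq> X closure_of ?O"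
    using continuous_map_image_closure_subset[of X X \<alpha> ?O] \<alpha>(1) closure_of_mono[of "\<alpha> ` ?O" ?O X]
    by (auto simp: carrier_continuous_Aut)
  moreover have "E w \<in> X closure_of ?O"
    using w by (simp add: orbit_closure_def)
  ultimately have "E w' \<in> X closure_of ?O"
    using \<alpha>(2) by (metis image_eqI subsetD)
  then show ?thesis
    using w' by (simp add: orbit_closure_def)
qed

lemma has_dense_orbitI:
  assumes v: "v \<in> V" and S: "S \<subseteq> orbit_closure v" "V \<subseteq> closure S"
  shows "has_dense_orbit X (continuous_Aut G X) (\<lambda>\<alpha>. \<alpha>)"
  unfolding has_dense_orbit_def
proof (intro bexI equalityI)
  show "E v \<in> topspace X"
    using E_carrier[OF v] topspace_X by simp
  show "X closure_of (orbit (continuous_Aut G X) (\<lambda>\<alpha>. \<alpha>) (E v)) \<subseteq> topspace X"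
    by (rule closure_of_subset_topspace)
  have "w \<in> orbit_closure v" if "w \<in> V" for w
    using that S closure_mono orbit_closure_closed by blast
  then have "E ` V \<subseteq> X closure_of (orbit (continuous_Aut G X) (\<lambda>\<alpha>. \<alpha>) (E v))"
    by (auto simp: orbit_closure_def)
  then show "topspace X \<subseteq> X closure_of (orbit (continuous_Aut G X) (\<lambda>\<alpha>. \<alpha>) (E v))"
    by (simp add: E_surj topspace_X)
qed

section \<open>Kernels that do not span\<close>

text \<open>The maps \<open>L\<close> below fix every point of \<open>\<Gamma>\<close>, because
  \<open>u\<close> is orthogonal to it, so their coefficients can be arbitrary reals.\<close>

lemma dense_orbit_if_not_spanning:
  assumes "\<not> V \<subseteq> span \<Gamma>"
  shows "has_dense_orbit X (continuous_Aut G X) (\<lambda>\<alpha>. \<alpha>)"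
proof -
  have spanV: "span V = V"
    using subspace_V by (simp add: span_eq_iff)
  have "span \<Gamma> \<subset> span V"
    using assms \<Gamma>_V spanV span_mono[of \<Gamma> V] by blast
  then obtain u where u: "u \<noteq> 0" "u \<in> V" "\<And>y. y \<in> span \<Gamma> \<Longrightarrow> orthogonal u y"
    using orthogonal_to_subspace_exists_gen spanV by metis
  have u\<Gamma>: "u \<bullet> y = 0" if "y \<in> \<Gamma>" for y
    using u(3)[OF span_base[OF that]] by (simp add: orthogonal_def)
  define S where "S = {z \<in> V. u \<bullet> z \<noteq> 0}"
  have "z \<in> orbit_closure u" if z: "z \<in> S" for z
  proof -
    \<comment> \<open>Chosen so that \<open>L u = z\<close>. The map \<open>L\<close> scales the
      component along \<open>u\<close> by \<open>s\<close>, which equals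
      \<open>u \<bullet> z / (u \<bullet> u)\<close>; hence it is invertible exactly because
      \<open>z\<close> lies off the hyperplane.\<close>
    define w where "w = (z - u) /\<^sub>R (u \<bullet> u)"
    have uu: "u \<bullet> u \<noteq> 0" using u by simp
    have w: "w \<in> V"
      using z u subspace_V by (auto simp: S_def w_def intro!: subspace_scale subspace_diff)
    define s where "s = 1 + u \<bullet> w"
    have "s = u \<bullet> z / (u \<bullet> u)"
      using uu by (simp add: s_def w_def inner_diff_right field_simps)
    then have s: "s \<noteq> 0"
      using z uu by (simp add: S_def)
    define L where "L = (\<lambda>v. v + (u \<bullet> v) *\<^sub>R w)"
    define L' where "L' = (\<lambda>v. v - ((u \<bullet> v) / s) *\<^sub>R w)"
    obtain \<alpha> where \<alpha>: "\<alpha> \<in> carrier (continuous_Aut G X)" "\<And>v. v \<in> V \<Longrightarrow> \<alpha> (E v) = E (L v)"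
    proof (rule induced_automorphism[of L L'])
      show "linear L"
        by (rule linearI) (simp_all add: L_def algebra_simps)
      show "L v \<in> V" "L' v \<in> V" if "v \<in> V" for v
        using that w subspace_V by (auto simp: L_def L'_def intro!: subspace_add subspace_diff subspace_scale)
      have uL: "u \<bullet> L v = s * (u \<bullet> v)" for v
        by (simp add: L_def s_def inner_add_right algebra_simps)
      have uL': "u \<bullet> L' v = (u \<bullet> v) / s" for v
        using s by (simp add: L'_def inner_diff_right field_simps) (simp add: s_def algebra_simps)
      show "L' (L v) = v" for v
        using s by (simp add: L'_def uL) (simp add: L_def)
      show "L (L' v) = v" for v
        by (simp add: L_def uL') (simp add: L'_def)
      show "L v \<in> \<Gamma>" "L' v \<in> \<Gamma>" if "v \<in> \<Gamma>" for v
        using that u\<Gamma> by (auto simp: L_def L'_def)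
    qed blast
    have "L u = z"
      using uu by (simp add: L_def w_def)
    then show ?thesis
      using orbit_in_orbit_closure \<alpha> u(2) z by (auto simp: S_def)
  qed
  moreover have "V \<subseteq> closure S"
  proof
    fix z assume z: "z \<in> V"
    show "z \<in> closure S"
    proof (cases "u \<bullet> z = 0")
      case True
      have "(\<lambda>n. z + (1 / real (Suc n)) *\<^sub>R u) \<longlonglongrightarrow> z + 0 *\<^sub>R u"
        by (intro tendsto_intros LIMSEQ_Suc lim_1_over_n)
      moreover have "z + (1 / real (Suc n)) *\<^sub>R u \<in> S" for n
        using True z u subspace_V by (auto simp: S_def inner_add_right intro!: subspace_add subspace_scale)
      ultimately show ?thesis
        unfolding closure_sequential by (intro exI[of _ "\<lambda>n. z + (1 / real (Suc n)) *\<^sub>R u"]) simp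
    next
      case False
      then show ?thesis
        using z closure_subset[of S] by (auto simp: S_def)
    qed
  qed
  ultimately show ?thesis
    using has_dense_orbitI[OF u(2)] by blast
qed

section \<open>Kernels that span in dimension at least two\<close>

text \<open>
  Reducing the multiples \<open>k \<gamma>\<close> modulo the lattice spanned by \<open>B\<close> leaves finitely many points of \<open>\<Gamma>\<close>, so
  two of them agree and some multiple of \<open>\<gamma>\<close> lies in that lattice.
\<close>

lemma bounded_denominators:
  fixes c :: "'e \<Rightarrow> 'e \<Rightarrow> real"
  assumes B: "finite B" "B \<subseteq> \<Gamma>"
    and c: "\<And>b. linear (c b)" "\<And>b x. x \<in> B \<Longrightarrow> b \<in> B \<Longrightarrow> c b x = (if x = b then 1 else 0)"
    and expand: "\<And>v. v \<in> V \<Longrightarrow> (\<Sum>b\<in>B. c b v *\<^sub>R b) = v"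
  obtains N where "(N::nat) > 0" "\<And>b \<gamma>. b \<in> B \<Longrightarrow> \<gamma> \<in> \<Gamma> \<Longrightarrow> real N * c b \<gamma> \<in> \<int>"
proof -
  define R where "R = (\<Sum>b\<in>B. norm b)"
  define F where "F = \<Gamma> \<inter> cball 0 R"
  have finF: "finite F"
    unfolding F_def by (rule finite_\<Gamma>_cball)
  \<comment> \<open>The factorial is divisible by every difference of two indices up to
    \<open>card F\<close>, so a single \<open>N\<close> serves all \<open>b\<close> and
    \<open>\<gamma>\<close>.\<close>
  define N :: nat where "N = fact (card F)"
  have "real N * c b \<gamma> \<in> \<int>" if b: "b \<in> B" and \<gamma>: "\<gamma> \<in> \<Gamma>" for b \<gamma>
  proof -
    define h where "h = (\<lambda>k::nat. real k *\<^sub>R \<gamma> - (\<Sum>b\<in>B. of_int \<lfloor>c b (real k *\<^sub>R \<gamma>)\<rfloor> *\<^sub>R b))"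
    have k\<gamma>: "real k *\<^sub>R \<gamma> \<in> \<Gamma>" for k
      using \<Gamma>_int[OF \<gamma>, of "int k"] by simp
    have "h k \<in> F" for k
    proof -
      have "h k \<in> \<Gamma>"
        unfolding h_def using k\<gamma> B(2) by (intro \<Gamma>_diff \<Gamma>_sum \<Gamma>_int) auto
      moreover have "h k = (\<Sum>b\<in>B. frac (c b (real k *\<^sub>R \<gamma>)) *\<^sub>R b)"
        unfolding h_def frac_def scaleR_diff_left sum_subtractf expand[OF \<Gamma>_V[OF k\<gamma>]] ..
      moreover have "norm (\<Sum>b\<in>B. frac (c b (real k *\<^sub>R \<gamma>)) *\<^sub>R b) \<le> R"
        unfolding R_def
      proof (rule sum_norm_le)
        fix b
        have "\<bar>frac (c b (real k *\<^sub>R \<gamma>))\<bar> * norm b \<le> 1 * norm b"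
          by (intro mult_right_mono) (auto simp: frac_ge_0 less_imp_le[OF frac_lt_1])
        then show "norm (frac (c b (real k *\<^sub>R \<gamma>)) *\<^sub>R b) \<le> norm b"
          by simp
      qed
      ultimately show ?thesis
        by (simp add: F_def)
    qed
    then have "card (h ` {..card F}) \<le> card F"
      using finF by (intro card_mono) auto
    \<comment> \<open>There are \<open>card F + 1\<close> indices, one more than \<open>F\<close>
      has elements.\<close>
    then have "\<not> inj_on h {..card F}"
      by (intro pigeonhole) simp
    then obtain k' l' where "k' \<le> card F" "l' \<le> card F" "k' \<noteq> l'" "h k' = h l'"
      unfolding inj_on_def by auto
    then obtain k l where kl: "k < l" "l \<le> card F" "h k = h l"
      by (metis nat_neq_iff)
    have ch: "c b (h k) = real k * c b \<gamma> - of_int \<lfloor>c b (real k *\<^sub>R \<gamma>)\<rfloor>" for k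
    proof -
      have "c b (\<Sum>x\<in>B. of_int \<lfloor>c x (real k *\<^sub>R \<gamma>)\<rfloor> *\<^sub>R x) =
            (\<Sum>x\<in>B. of_int \<lfloor>c x (real k *\<^sub>R \<gamma>)\<rfloor> * c b x)"
        by (simp add: linear_sum[OF c(1)] linear_scale[OF c(1)])
      also have "\<dots> = (\<Sum>x\<in>B. if x = b then of_int \<lfloor>c b (real k *\<^sub>R \<gamma>)\<rfloor> else 0)"
        by (rule sum.cong) (use c(2) b in auto)
      also have "\<dots> = of_int \<lfloor>c b (real k *\<^sub>R \<gamma>)\<rfloor>"
        using B(1) b by simp
      finally show ?thesis
        by (simp add: h_def linear_diff[OF c(1)] linear_scale[OF c(1)])
    qed
    have "real (l - k) * c b \<gamma> = of_int (\<lfloor>c b (real l *\<^sub>R \<gamma>)\<rfloor> - \<lfloor>c b (real k *\<^sub>R \<gamma>)\<rfloor>)"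
      using ch[of k] ch[of l] kl by (simp add: of_nat_diff algebra_simps)
    then have int: "real (l - k) * c b \<gamma> \<in> \<int>"
      using Ints_of_int by metis
    have "l - k dvd N"
      unfolding N_def using kl by (intro dvd_fact) auto
    then obtain m where m: "N = (l - k) * m" ..
    have "real N * c b \<gamma> = real m * (real (l - k) * c b \<gamma>)"
      unfolding m of_nat_mult by (simp add: mult_ac)
    then show ?thesis
      using int Ints_mult[OF Ints_of_nat] by metis
  qed
  moreover have "N > 0"
    by (simp add: N_def)
  ultimately show thesis
    using that by blast
qed

text \<open>A maximal independent subset of \<open>\<Gamma>\<close> is a basis of \<open>V\<close>.
  Its dual functionals are extended linearly to the whole Euclidean space, and
  \<open>bounded_denominators\<close> supplies \<open>N\<close>.\<close>

lemma lattice_coordinates: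
  assumes "V \<subseteq> span \<Gamma>"
  obtains B c N where "finite B" "B \<subseteq> \<Gamma>" "independent B" "card B = dim V"
    "\<And>b. linear (c b)" "\<And>b x. x \<in> B \<Longrightarrow> b \<in> B \<Longrightarrow> c b x = (if x = b then 1 else 0 :: real)"
    "\<And>v. v \<in> V \<Longrightarrow> (\<Sum>b\<in>B. c b v *\<^sub>R b) = v"
    "N > (0::nat)" "\<And>b \<gamma>. b \<in> B \<Longrightarrow> \<gamma> \<in> \<Gamma> \<Longrightarrow> real N * c b \<gamma> \<in> \<int>"
proof -
  obtain B where B: "B \<subseteq> \<Gamma>" "independent B" "\<Gamma> \<subseteq> span B"
    using maximal_independent_subset by blast
  have finB: "finite B"
    using B(2) independent_imp_finite by blast
  have "span \<Gamma> \<subseteq> span B"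
    using B(3) span_mono span_span by metis
  then have spanB: "V \<subseteq> span B"
    using assms by blast
  then have card: "card B = dim V"
    using B \<Gamma>_V basis_card_eq_dim[of B V] by blast
  have "\<forall>b. \<exists>g. linear g \<and> (\<forall>x\<in>B. g x = (if x = b then 1 else 0 :: real))"
    by (intro allI linear_independent_extend[OF B(2)])
  then obtain c where c: "\<And>b. linear (c b)" "\<And>b x. x \<in> B \<Longrightarrow> c b x = (if x = b then 1 else 0 :: real)"
    by metis
  have expand: "(\<Sum>b\<in>B. c b v *\<^sub>R b) = v" if "v \<in> V" for v
  proof (rule linear_eq_on_span[of "\<lambda>v. \<Sum>b\<in>B. c b v *\<^sub>R b" "\<lambda>v. v" B])
    show "linear (\<lambda>v. \<Sum>b\<in>B. c b v *\<^sub>R b)"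
      by (intro linear_compose_sum ballI linearI)
        (simp_all add: linear_add[OF c(1)] linear_scale[OF c(1)] algebra_simps)
    show "(\<Sum>b\<in>B. c b x *\<^sub>R b) = x" if x: "x \<in> B" for x
    proof -
      have "(\<Sum>b\<in>B. c b x *\<^sub>R b) = (\<Sum>b\<in>B. if b = x then x else 0)"
        by (rule sum.cong) (use c(2) x in auto)
      then show ?thesis
        using finB x by simp
    qed
  qed (use that spanB in \<open>auto simp: linear_ident\<close>)
  obtain N where "N > (0::nat)" "\<And>b \<gamma>. b \<in> B \<Longrightarrow> \<gamma> \<in> \<Gamma> \<Longrightarrow> real N * c b \<gamma> \<in> \<int>"
    using bounded_denominators[OF finB B(1) c(1) c(2) expand] by blast
  then show thesis
    using that[OF finB B(1,2) card c(1) c(2) expand] by blast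
qed

text \<open>The start \<open>x0\<close> has the irrational coordinate \<open>\<xi>\<close> at
  \<open>i\<close>. That coordinate lets every other one be filled (\<open>box\<close>); an
  irrational coordinate at \<open>j\<close> then lets the one at \<open>i\<close> be filled
  (\<open>irr\<close>), and vectors with irrational coordinate at \<open>j\<close> are
  dense.\<close>

lemma dense_orbit_if_spanning:
  assumes "V \<subseteq> span \<Gamma>" and "dim V \<ge> 2"
  shows "has_dense_orbit X (continuous_Aut G X) (\<lambda>\<alpha>. \<alpha>)"
proof -
  obtain B c N where finB: "finite B" and B: "B \<subseteq> \<Gamma>" "independent B" "card B = dim V"
    and c: "\<And>b. linear (c b)" "\<And>b x. x \<in> B \<Longrightarrow> b \<in> B \<Longrightarrow> c b x = (if x = b then 1 else 0 :: real)"
    and expand: "\<And>v. v \<in> V \<Longrightarrow> (\<Sum>b\<in>B. c b v *\<^sub>R b) = v"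
    and N: "N > (0::nat)" "\<And>b \<gamma>. b \<in> B \<Longrightarrow> \<gamma> \<in> \<Gamma> \<Longrightarrow> real N * c b \<gamma> \<in> \<int>"
    by (rule lattice_coordinates[OF assms(1)]) blast
  have BV: "b \<in> V" if "b \<in> B" for b
    using that B(1) \<Gamma>_V by blast
  obtain i where i: "i \<in> B"
  proof -
    have "card B > 0"
      using B(3) assms(2) by linarith
    then have "B \<noteq> {}"
      by (metis card.empty less_irrefl)
    then show ?thesis
      using that by blast
  qed
  obtain j where j: "j \<in> B" "j \<noteq> i"
  proof -
    have "card (B - {i}) > 0"
      using B(3) assms(2) i finB by simp
    then have "B - {i} \<noteq> {}"
      by (metis card.empty less_irrefl)
    then show ?thesis
      using that by blast
  qed
  obtain \<xi> :: real where \<xi>: "\<xi> \<notin> \<rat>"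
    using uncountable_UNIV_real countable_rat by (metis UNIV_eq_I)
  define x0 where "x0 = \<xi> *\<^sub>R i"
  have x0V: "x0 \<in> V"
    using BV[OF i] subspace_V by (simp add: x0_def subspace_scale)
  define D where "D = orbit_closure x0"
  have DV: "v \<in> V" if "v \<in> D" for v
    using that by (simp add: D_def orbit_closure_def)
  \<comment> \<open>The factor \<open>N\<close> makes the coefficient of \<open>b\<close> an integer
    on \<open>\<Gamma>\<close>, so \<open>\<Gamma>\<close> is preserved; \<open>a \<noteq> b\<close>
    makes the map for \<open>- k\<close> the inverse.\<close>
  have transvection: "v + (of_int k * (real N * c a v)) *\<^sub>R b \<in> D"
    if v: "v \<in> D" and ab: "a \<in> B" "b \<in> B" "a \<noteq> b" for v a b k
  proof -
    define L where "L = (\<lambda>k::int. \<lambda>v. v + (of_int k * (real N * c a v)) *\<^sub>R b)"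
    have LV: "L k v \<in> V" if "v \<in> V" for v k
      using that BV[OF ab(2)] subspace_V by (simp add: L_def subspace_add subspace_scale)
    have L\<Gamma>: "L k v \<in> \<Gamma>" if v\<Gamma>: "v \<in> \<Gamma>" for v k
    proof -
      obtain m where m: "real N * c a v = of_int m"
        using N(2)[OF ab(1) v\<Gamma>] Ints_cases by metis
      have "of_int (k * m) *\<^sub>R b \<in> \<Gamma>"
        using B(1) ab(2) by (intro \<Gamma>_int) auto
      then show ?thesis
        unfolding L_def m using \<Gamma>_add[OF v\<Gamma>] by simp
    qed
    have "c a b = 0"
      using c(2)[OF ab(2,1)] ab(3) by simp
    then have inv: "L (- k) (L k v) = v" for k v
      by (simp add: L_def linear_add[OF c(1)] linear_scale[OF c(1)])
    obtain \<alpha> where \<alpha>: "\<alpha> \<in> carrier (continuous_Aut G X)" "\<And>v. v \<in> V \<Longrightarrow> \<alpha> (E v) = E (L k v)"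
    proof (rule induced_automorphism[of "L k" "L (- k)"])
      show "linear (L k)"
        by (rule linearI) (simp_all add: L_def linear_add[OF c(1)] linear_scale[OF c(1)] algebra_simps)
      show "L k (L (- k) v) = v" for v
        using inv[of "- k"] by simp
    qed (use LV L\<Gamma> inv in auto)
    have "L k v \<in> D"
      using orbit_closure_automorphism[OF x0V v[unfolded D_def] LV[OF DV[OF v]] \<alpha>(1)] \<alpha>(2)[OF DV[OF v]]
      by (simp add: D_def)
    then show ?thesis
      by (simp add: L_def)
  qed
  \<comment> \<open>For irrational \<open>\<theta> = real N * c a v\<close>, the numbers
    \<open>k * \<theta> - h\<close> with integers \<open>k\<close> and \<open>h\<close> are dense in
    the reals, so the points reached fill the line in the direction \<open>b\<close>.\<close>
  have line: "v + t *\<^sub>R b \<in> D" if v: "v \<in> D" and ab: "a \<in> B" "b \<in> B" "a \<noteq> b" and irr: "c a v \<notin> \<rat>" for v a b t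
    unfolding D_def
  proof (rule orbit_closure_closed)
    show "v + t *\<^sub>R b \<in> V"
      using DV[OF v] BV[OF ab(2)] subspace_V by (simp add: subspace_add subspace_scale)
    have "b \<noteq> 0"
      using ab(2) B(2) dependent_zero by blast
    have irrN: "real N * c a v \<notin> \<rat>"
    proof
      assume "real N * c a v \<in> \<rat>"
      then have "real N * c a v / real N \<in> \<rat>"
        by (intro Rats_divide) auto
      then show False
        using N(1) irr by simp
    qed
    show "v + t *\<^sub>R b \<in> closure (orbit_closure x0)"
      unfolding closure_approachable
    proof (intro allI impI)
      fix e :: real assume "e > 0"
      then have "e / norm b > 0"
        using \<open>b \<noteq> 0\<close> by simp
      then obtain h k where hk: "\<bar>of_int k * (real N * c a v) - of_int h - t\<bar> < e / norm b"
        using sequence_of_fractional_parts_is_dense[OF irrN] by metis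
      \<comment> \<open>The transvection contributes the multiple with \<open>k\<close>; the shift
        by \<open>- h\<close> is a translation by an element of \<open>\<Gamma>\<close>.\<close>
      define w where "w = v + (of_int k * (real N * c a v)) *\<^sub>R b + of_int (- h) *\<^sub>R b"
      have "w \<in> D"
        unfolding w_def D_def
        by (rule orbit_closure_\<Gamma>[OF transvection[OF v ab, unfolded D_def] \<Gamma>_int]) (use ab B in auto)
      moreover have "w - (v + t *\<^sub>R b) = (of_int k * (real N * c a v) - of_int h - t) *\<^sub>R b"
        by (simp add: w_def algebra_simps)
      then have "dist w (v + t *\<^sub>R b) < e"
        using hk \<open>b \<noteq> 0\<close> by (simp add: dist_norm pos_less_divide_eq)
      ultimately show "\<exists>w\<in>orbit_closure x0. dist w (v + t *\<^sub>R b) < e"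
        unfolding D_def by blast
    qed
  qed
  \<comment> \<open>The coordinate at \<open>i\<close> stays equal to \<open>\<xi>\<close>
    throughout, so it drives the filling of each further coordinate.\<close>
  have box: "x0 + (\<Sum>b\<in>S. t b *\<^sub>R b) \<in> D" if "finite S" "S \<subseteq> B - {i}" for S t
    using that
  proof (induction S)
    case empty
    then show ?case
      using orbit_closure_refl[OF x0V] by (simp add: D_def)
  next
    case (insert b S)
    let ?v = "x0 + (\<Sum>b\<in>S. t b *\<^sub>R b)"
    have "(\<Sum>b\<in>S. t b * c i b) = 0"
    proof (intro sum.neutral ballI)
      fix b assume "b \<in> S"
      then have "b \<in> B" "b \<noteq> i"
        using insert.prems by auto
      then show "t b * c i b = 0"
        using c(2)[OF _ i] by simp
    qed
    then have "c i ?v = \<xi>"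
      using c(2)[OF i i] by (simp add: x0_def linear_add[OF c(1)] linear_sum[OF c(1)] linear_scale[OF c(1)])
    then have "?v + t b *\<^sub>R b \<in> D"
      using insert i \<xi> by (intro line[of _ i]) auto
    then show ?case
      using insert.hyps by (simp add: add_ac)
  qed
  \<comment> \<open>The roles are exchanged: the irrational coordinate at \<open>j\<close> now
    drives the filling of the one at \<open>i\<close>.\<close>
  have irr: "v \<in> D" if v: "v \<in> V" "c j v \<notin> \<rat>" for v
  proof -
    define w where "w = x0 + (\<Sum>b\<in>B - {i}. c b v *\<^sub>R b)"
    have "w \<in> D"
      unfolding w_def by (rule box) (use finB in auto)
    have "v = c i v *\<^sub>R i + (\<Sum>b\<in>B - {i}. c b v *\<^sub>R b)"
      using expand[OF v(1)] sum.remove[OF finB i, of "\<lambda>b. c b v *\<^sub>R b"] by simp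
    then have vw: "v = w + (c i v - \<xi>) *\<^sub>R i"
      by (simp add: w_def x0_def algebra_simps)
    have "c j v = c j w"
      using c(2)[OF i j(1)] j(2) by (subst vw) (simp add: linear_add[OF c(1)] linear_scale[OF c(1)])
    then have "w + (c i v - \<xi>) *\<^sub>R i \<in> D"
      using line[OF \<open>w \<in> D\<close> j(1) i j(2)] v(2) by simp
    then show ?thesis
      using vw by simp
  qed
  have "V \<subseteq> closure D"
  proof
    fix v assume v: "v \<in> V"
    show "v \<in> closure D"
    proof (cases "c j v \<in> \<rat>")
      case True
      \<comment> \<open>A rational coordinate becomes irrational after adding
        \<open>\<xi> / real (Suc n)\<close>.\<close>
      let ?s = "\<lambda>n. v + (\<xi> / real (Suc n)) *\<^sub>R j"
      have "(\<lambda>n. \<xi> * (1 / real (Suc n))) \<longlonglongrightarrow> \<xi> * 0"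
        by (intro tendsto_intros LIMSEQ_Suc lim_1_over_n)
      then have "?s \<longlonglongrightarrow> v + 0 *\<^sub>R j"
        by (intro tendsto_intros) simp
      moreover have "?s n \<in> D" for n
      proof (rule irr)
        show "?s n \<in> V"
          using v BV[OF j(1)] subspace_V by (simp add: subspace_add subspace_scale)
        show "c j (?s n) \<notin> \<rat>"
        proof
          assume "c j (?s n) \<in> \<rat>"
          then have "(c j (?s n) - c j v) * real (Suc n) \<in> \<rat>"
            using True by (intro Rats_mult Rats_diff) auto
          moreover have "(c j (?s n) - c j v) * real (Suc n) = \<xi>"
            using c(2)[OF j(1) j(1)]
            by (simp add: linear_add[OF c(1)] linear_scale[OF c(1)] del: of_nat_Suc)
          ultimately show False
            using \<xi> by simp
        qed
      qed
      ultimately show ?thesis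
        unfolding closure_sequential by (intro exI[of _ ?s]) simp
    next
      case False
      then show ?thesis
        using irr[OF v] closure_subset[of D] by blast
    qed
  qed
  then show ?thesis
    using has_dense_orbitI[OF x0V, of D] by (simp add: D_def)
qed

section \<open>One-dimensional quotients and the circle\<close>

text \<open>The functional \<open>f\<close> takes integer values on \<open>\<Gamma>\<close>. An
  element with the least positive value generates \<open>\<Gamma>\<close>, by division with
  remainder.\<close>

lemma rank_one_kernel:
  assumes "V \<subseteq> span \<Gamma>" and "dim V = 1"
  obtains \<gamma> c where "\<gamma> \<in> \<Gamma>" "\<gamma> \<noteq> 0" "linear c" "\<And>v. v \<in> V \<Longrightarrow> v = c v *\<^sub>R \<gamma>" "c \<gamma> = (1::real)"
    "\<And>v. v \<in> V \<Longrightarrow> v \<in> \<Gamma> \<longleftrightarrow> c v \<in> \<int>"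
proof -
  obtain B c N where finB: "finite B" and B: "B \<subseteq> \<Gamma>" "independent B" "card B = dim V"
    and c: "\<And>b. linear (c b)" "\<And>b x. x \<in> B \<Longrightarrow> b \<in> B \<Longrightarrow> c b x = (if x = b then 1 else 0 :: real)"
    and expand: "\<And>v. v \<in> V \<Longrightarrow> (\<Sum>b\<in>B. c b v *\<^sub>R b) = v"
    and N: "N > (0::nat)" "\<And>b \<gamma>. b \<in> B \<Longrightarrow> \<gamma> \<in> \<Gamma> \<Longrightarrow> real N * c b \<gamma> \<in> \<int>"
    by (rule lattice_coordinates[OF assms(1)]) blast
  obtain b where b: "B = {b}"
    using B(3) assms(2) card_1_singletonE by metis
  define f where "f = (\<lambda>v. real N * c b v)"
  have f_int: "f \<gamma> \<in> \<int>" if "\<gamma> \<in> \<Gamma>" for \<gamma>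
    using N(2)[of b] that b by (simp add: f_def)
  have lin_f: "linear f"
    by (rule linearI) (simp_all add: f_def linear_add[OF c(1)] linear_scale[OF c(1)] algebra_simps)
  let ?P = "\<lambda>m. m > 0 \<and> (\<exists>\<gamma>\<in>\<Gamma>. f \<gamma> = real m)"
  have "?P N"
    using N(1) b B(1) c(2)[of b b] by (auto simp: f_def)
  define m where "m = (LEAST m. ?P m)"
  have m: "?P m"
    unfolding m_def by (rule LeastI[of ?P, OF \<open>?P N\<close>])
  then obtain \<gamma> where \<gamma>: "\<gamma> \<in> \<Gamma>" "f \<gamma> = real m" by blast
  define c' where "c' = (\<lambda>v. f v / real m)"
  have v_eq: "v = c' v *\<^sub>R \<gamma>" if v: "v \<in> V" for v
  proof -
    have "c b v *\<^sub>R b = v" "c b \<gamma> *\<^sub>R b = \<gamma>"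
      using expand[OF v] expand[OF \<Gamma>_V[OF \<gamma>(1)]] b by simp_all
    moreover have "c' v * c b \<gamma> = c b v"
    proof -
      have "c b \<gamma> = real m / real N"
        using \<gamma>(2) N(1) by (simp add: f_def field_simps)
      then show ?thesis
        using m N(1) by (simp add: c'_def f_def)
    qed
    ultimately show ?thesis
      by (metis scaleR_scaleR)
  qed
  have int_if: "c' v \<in> \<int>" if v: "v \<in> \<Gamma>" for v
  proof (rule ccontr)
    assume nonint: "c' v \<notin> \<int>"
    \<comment> \<open>The remainder \<open>w\<close> of the division of \<open>v\<close> by
      \<open>\<gamma>\<close> would have a value of \<open>f\<close> strictly between 0 and
      \<open>m\<close>, against minimality.\<close>
    define q where "q = \<lfloor>c' v\<rfloor>"
    define w where "w = v - of_int q *\<^sub>R \<gamma>"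
    have w: "w \<in> \<Gamma>"
      using v \<Gamma>_int[OF \<gamma>(1)] \<Gamma>_diff by (simp add: w_def)
    have fw: "f w = frac (c' v) * real m"
      using m \<gamma>(2) by (simp add: w_def q_def frac_def linear_diff[OF lin_f] linear_scale[OF lin_f] c'_def algebra_simps)
    have "frac (c' v) > 0"
      using nonint by (simp add: frac_gt_0_iff)
    then have pos: "f w > 0" and less: "f w < real m"
      using fw m frac_lt_1[of "c' v"] by (simp_all add: mult_less_cancel_right1)
    obtain z where z: "f w = of_int z"
      using f_int[OF w] Ints_cases by metis
    then have "f w = real (nat z)" "nat z > 0" "nat z < m"
      using pos less by auto
    then have "?P (nat z)" "nat z < m"
      using w by auto
    then show False
      unfolding m_def using not_less_Least[of "nat z" ?P] by blast
  qed
  show thesis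
  proof (rule that[of \<gamma> c'])
    show "\<gamma> \<in> \<Gamma>" by (rule \<gamma>)
    show "\<gamma> \<noteq> 0"
      using \<gamma>(2) m linear_0[OF lin_f] by auto
    show "linear c'"
      by (rule linearI) (simp_all add: c'_def linear_add[OF lin_f] linear_scale[OF lin_f] add_divide_distrib)
    show "v = c' v *\<^sub>R \<gamma>" if "v \<in> V" for v
      by (rule v_eq[OF that])
    show "c' \<gamma> = 1"
      using \<gamma>(2) m by (simp add: c'_def)
    show "v \<in> \<Gamma> \<longleftrightarrow> c' v \<in> \<int>" if "v \<in> V" for v
    proof
      assume "c' v \<in> \<int>"
      then obtain k where "c' v = of_int k"
        using Ints_cases by metis
      then have "v = of_int k *\<^sub>R \<gamma>"
        using v_eq[OF that] by metis
      then show "v \<in> \<Gamma>"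
        using \<Gamma>_int[OF \<gamma>(1)] by metis
    qed (rule int_if)
  qed
qed

text \<open>The winding map \<open>f\<close> has kernel exactly \<open>\<Gamma>\<close> on
  \<open>V\<close>, so it descends to a continuous bijective homomorphism \<open>h\<close> onto the
  circle. The group is the image of the segment from 0 to \<open>\<gamma>\<close>, hence compact,
  which makes \<open>h\<close> a homeomorphism.\<close>

lemma circle_if_rank_one:
  assumes "V \<subseteq> span \<Gamma>" and "dim V = 1"
  shows "topologically_isomorphic G X circle_group circle_topology"
proof -
  obtain \<gamma> c where \<gamma>: "\<gamma> \<in> \<Gamma>" "\<gamma> \<noteq> 0" and c: "linear c" "\<And>v. v \<in> V \<Longrightarrow> v = c v *\<^sub>R \<gamma>" "c \<gamma> = (1::real)"
    and \<Gamma>_iff: "\<And>v. v \<in> V \<Longrightarrow> v \<in> \<Gamma> \<longleftrightarrow> c v \<in> \<int>"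
    by (rule rank_one_kernel[OF assms]) blast
  define f where "f = (\<lambda>v. cis (2 * pi * c v))"
  define h where "h = (\<lambda>g. f (section_E g))"
  have f_eq_iff: "f v = f w \<longleftrightarrow> c (v - w) \<in> \<int>" for v w
  proof -
    have "f v = f w \<longleftrightarrow> cis (2 * pi * c v) / cis (2 * pi * c w) = 1"
      by (simp add: f_def)
    also have "\<dots> \<longleftrightarrow> cis (2 * pi * c (v - w)) = 1"
      by (simp add: cis_divide linear_diff[OF c(1)] algebra_simps)
    also have "\<dots> \<longleftrightarrow> c (v - w) \<in> \<int>"
      by (rule cis_2pi_eq_1_iff)
    finally show ?thesis .
  qed
  have hE: "h (E v) = f v" if v: "v \<in> V" for v
  proof -
    have "section_E (E v) - v \<in> V"
      using section_E(1)[OF v] v subspace_diff[OF subspace_V] by blast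
    then show ?thesis
      using section_E(3)[OF v] \<Gamma>_iff f_eq_iff by (simp add: h_def)
  qed
  have fE: "f v = f w \<longleftrightarrow> E v = E w" if "v \<in> V" "w \<in> V" for v w
    using f_eq_iff E_eq_iff[OF that] \<Gamma>_iff that subspace_diff[OF subspace_V] by blast
  have surj: "\<exists>v\<in>V. g = E v" if "g \<in> carrier G" for g
    using that E_surj by blast
  have inj: "inj_on h (carrier G)"
    by (rule inj_onI) (metis surj hE fE)
  have img: "h ` carrier G = sphere 0 1"
  proof
    show "h ` carrier G \<subseteq> sphere 0 1"
      by (auto simp: h_def f_def)
    show "sphere 0 1 \<subseteq> h ` carrier G"
    proof
      fix z :: complex assume "z \<in> sphere 0 1"
      then have z: "z = cis (Arg z)"
        using cis_Arg[of z] by (metis dist_0_norm mem_sphere norm_zero sgn_div_norm zero_neq_one inverse_1 scaleR_one)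
      define v where "v = (Arg z / (2 * pi)) *\<^sub>R \<gamma>"
      have "v \<in> V"
        using \<Gamma>_V[OF \<gamma>(1)] subspace_V by (simp add: v_def subspace_scale)
      moreover have "f v = z"
        using z by (simp add: f_def v_def linear_scale[OF c(1)] c(3))
      ultimately show "z \<in> h ` carrier G"
        using hE E_carrier by (metis imageI)
    qed
  qed
  have "continuous_map (top_of_set V) circle_topology f"
    unfolding f_def using linear_continuous_on[OF linear_conv_bounded_linear[THEN iffD1, OF c(1)]]
    by (auto simp: cis_conv_exp intro!: continuous_intros)
  then have cont: "continuous_map X circle_topology h"
    by (rule continuous_descends) (rule hE)
  have "compact_space X"
  proof -
    let ?K = "(\<lambda>t. t *\<^sub>R \<gamma>) ` {0..1}"
    have KV: "?K \<subseteq> V"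
      using \<Gamma>_V[OF \<gamma>(1)] subspace_V by (auto simp: subspace_scale)
    have "compact ?K"
      by (intro compact_continuous_image continuous_intros) auto
    then have "compactin (top_of_set V) ?K"
      using KV by (simp add: compactin_subtopology)
    then have "compactin X (E ` ?K)"
      using image_compactin E_continuous by blast
    moreover have "E ` ?K = topspace X"
    proof
      show "E ` ?K \<subseteq> topspace X"
        using KV E_carrier topspace_X by auto
      show "topspace X \<subseteq> E ` ?K"
      proof
        fix g assume "g \<in> topspace X"
        then obtain v where v: "v \<in> V" "g = E v"
          using surj topspace_X by blast
        define w where "w = frac (c v) *\<^sub>R \<gamma>"
        have "w \<in> ?K"
          by (auto simp: w_def frac_ge_0 less_imp_le[OF frac_lt_1])
        moreover have "c (v - w) = of_int \<lfloor>c v\<rfloor>"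
          by (simp add: w_def linear_diff[OF c(1)] linear_scale[OF c(1)] c(3) frac_def)
        then have "E v = E w"
          using f_eq_iff fE v(1) KV \<open>w \<in> ?K\<close> by (metis Ints_of_int subsetD)
        ultimately show "g \<in> E ` ?K"
          using v(2) by blast
      qed
    qed
    ultimately show ?thesis
      by (simp add: compact_space_def)
  qed
  then have "homeomorphic_map X circle_topology h"
    by (intro continuous_imp_homeomorphic_map cont) (simp_all add: Hausdorff_space_subtopology img inj topspace_X)
  moreover have "h \<in> iso G circle_group"
  proof (rule isoI)
    show "h \<in> hom G circle_group"
    proof (rule homI)
      show "h g \<in> carrier circle_group" if "g \<in> carrier G" for g
        using that img by (auto simp: circle_group_def)
      show "h (g \<otimes> g') = h g \<otimes>\<^bsub>circle_group\<^esub> h g'" if gg: "g \<in> carrier G" "g' \<in> carrier G" for g g'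
      proof -
        obtain v w where vw: "v \<in> V" "w \<in> V" "g = E v" "g' = E w"
          using surj gg by metis
        have "h (g \<otimes> g') = f (v + w)"
          using vw hE[of "v + w"] E_add[of v w] subspace_add[OF subspace_V] by simp
        then show ?thesis
          using vw hE by (simp add: f_def circle_group_def linear_add[OF c(1)] cis_mult algebra_simps)
      qed
    qed
    show "bij_betw h (carrier G) (carrier circle_group)"
      using inj img by (simp add: bij_betw_def circle_group_def)
  qed
  ultimately show ?thesis
    unfolding topologically_isomorphic_def by blast
qed

end

section \<open>Automorphisms of the circle\<close>

text \<open>Cauchy's functional equation: additivity gives the formula at rational arguments, and
  continuity extends it to all reals.\<close>

lemma continuous_additive_real_scaleR:
  fixes a :: "real \<Rightarrow> 'b::real_normed_vector"
  assumes cont: "continuous_on UNIV a" and add: "\<And>s t. a (s + t) = a s + a t"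
  shows "a t = t *\<^sub>R a 1"
proof -
  have a0: "a 0 = 0"
    using add[of 0 0] by simp
  have neg: "a (- x) = - a x" for x
    using add[of x "- x"] a0 by (simp add: eq_neg_iff_add_eq_0 add.commute)
  have nat: "a (real n * x) = real n *\<^sub>R a x" for n x
    by (induction n) (simp_all add: a0 add distrib_right scaleR_left_distrib)
  have int: "a (of_int k * x) = of_int k *\<^sub>R a x" for k :: int and x
    by (cases k) (use nat neg in \<open>simp_all del: of_nat_Suc\<close>)
  have rat: "a r = r *\<^sub>R a 1" if r: "r \<in> \<rat>" for r
  proof -
    obtain p q :: int where pq: "q > 0" "r = of_int p / of_int q"
      using Rats_cases'[OF r] by metis
    have "of_int q *\<^sub>R a r = of_int p *\<^sub>R a 1"
      using int[of q r] int[of p 1] pq by simp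
    then have "inverse (of_int q) *\<^sub>R (of_int q *\<^sub>R a r) = inverse (of_int q) *\<^sub>R (of_int p *\<^sub>R a 1)"
      by simp
    then show ?thesis
      using pq by (simp add: divide_inverse mult.commute)
  qed
  have "closed {t. a t = t *\<^sub>R a 1}"
    using cont by (intro closed_Collect_eq continuous_intros) auto
  then have "closure \<rat> \<subseteq> {t. a t = t *\<^sub>R a 1}"
    using rat closure_minimal[of \<rat> "{t. a t = t *\<^sub>R a 1}"] by blast
  then show ?thesis
    by (auto simp: Rats_closure_real)
qed

text \<open>On the real line, \<open>\<beta> (cis t)\<close> has a continuous logarithm
  \<open>g\<close>. Its defect \<open>k\<close> of additivity takes values in the discrete set of
  integer multiples of \<open>2 * pi * \<i>\<close>, hence is constant, and \<open>g\<close> is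
  affine. So \<open>\<beta>\<close> is a power map with some integer exponent \<open>n\<close>, and
  injectivity leaves \<open>n = 1\<close> or \<open>n = -1\<close>.\<close>

lemma circle_automorphism:
  fixes \<beta> :: "complex \<Rightarrow> complex"
  assumes cont: "continuous_on (sphere 0 1) \<beta>" and im: "\<And>z. z \<in> sphere 0 1 \<Longrightarrow> \<beta> z \<in> sphere 0 1"
    and mult: "\<And>z w. z \<in> sphere 0 1 \<Longrightarrow> w \<in> sphere 0 1 \<Longrightarrow> \<beta> (z * w) = \<beta> z * \<beta> w"
    and inj: "inj_on \<beta> (sphere 0 1)" and z: "z \<in> sphere 0 1"
  shows "\<beta> z = z \<or> \<beta> z = inverse z"
proof -
  define f where "f = (\<lambda>t. \<beta> (cis t))"
  have f_add: "f (s + t) = f s * f t" for s t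
    using mult[of "cis s" "cis t"] by (simp add: f_def cis_mult)
  have f_nz: "f t \<noteq> 0" for t
    using im[of "cis t"] by (auto simp: f_def)
  have f0: "f 0 = 1"
    using f_add[of 0 0] f_nz[of 0] by simp
  have f_cont: "continuous_on UNIV f"
    unfolding f_def
    by (rule continuous_on_compose2[OF cont]) (auto simp: cis_conv_exp intro!: continuous_intros)
  obtain g where g_cont: "continuous_on UNIV g" and g: "\<And>t. f t = exp (g t)"
    using continuous_logarithm_on_contractible[OF f_cont contractible_UNIV] f_nz by auto
  define k where "k = (\<lambda>(s, t). g (s + t) - g s - g t)"
  have exp_k: "exp (k u) = 1" for u
    using f_add[of "fst u" "snd u"] f_nz[of "fst u"] f_nz[of "snd u"]
    by (simp add: k_def case_prod_unfold exp_diff g[symmetric])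
  have "k constant_on UNIV"
  proof (rule continuous_discrete_range_constant)
    show "continuous_on UNIV k"
      unfolding k_def case_prod_unfold
      by (intro continuous_intros continuous_on_compose2[OF g_cont]) auto
    show "\<exists>e>0. \<forall>y. y \<in> UNIV \<and> k y \<noteq> k x \<longrightarrow> e \<le> norm (k y - k x)" for x
    proof (intro exI[of _ "2 * pi"] conjI allI impI)
      fix y assume y: "y \<in> UNIV \<and> k y \<noteq> k x"
      have "exp (k y - k x) = 1"
        using exp_k by (simp add: exp_diff)
      then obtain n :: int where n: "Re (k y - k x) = 0" "Im (k y - k x) = of_int (2 * n) * pi"
        unfolding exp_eq_1 by blast
      have "n \<noteq> 0"
        using n y by (auto simp: complex_eq_iff)
      then have "1 \<le> \<bar>real_of_int n\<bar>"
        by linarith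
      then have "2 * pi \<le> \<bar>Im (k y - k x)\<bar>"
        unfolding n(2) by (simp add: abs_mult)
      also have "\<dots> \<le> norm (k y - k x)"
        by (rule abs_Im_le_cmod)
      finally show "2 * pi \<le> norm (k y - k x)" .
    qed simp
  qed (rule connected_UNIV)
  then have k: "k (s, t) = k (0, 0)" for s t
    unfolding constant_on_def by (metis UNIV_I)
  \<comment> \<open>The constant value of \<open>k\<close> is \<open>k (0, 0) = - g 0\<close>, so
    subtracting \<open>g 0\<close> makes \<open>g\<close> additive.\<close>
  define a where "a = (\<lambda>t. g t - g 0)"
  have a: "a t = t *\<^sub>R a 1" for t
  proof (rule continuous_additive_real_scaleR)
    show "continuous_on UNIV a"
      unfolding a_def by (intro continuous_intros g_cont)
    show "a (s + t) = a s + a t" for s t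
      using k[of s t] by (simp add: k_def a_def algebra_simps)
  qed
  have f_exp: "f t = exp (t *\<^sub>R a 1)" for t
  proof -
    have "exp (t *\<^sub>R a 1) = exp (a t)"
      using a[of t] by simp
    then show ?thesis
      using f0 by (simp add: a_def exp_diff g[symmetric])
  qed
  \<comment> \<open>The period \<open>2 * pi\<close> of \<open>cis\<close> forces the exponent to be
    an integer.\<close>
  have "exp ((2 * pi) *\<^sub>R a 1) = 1"
    using f_exp[of "2 * pi"] f0 by (simp add: f_def)
  then obtain n :: int where "Re (a 1) = 0" "Im (a 1) = of_int n"
    unfolding exp_eq_1 by auto
  then have "t *\<^sub>R a 1 = \<i> * of_real (of_int n * t)" for t
    by (simp add: complex_eq_iff)
  then have f_cis: "f t = cis (of_int n * t)" for t
    using f_exp by (simp add: cis_conv_exp)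
  have f_eq_1: "cis t = 1" if "f t = 1" for t
    using inj_onD[OF inj, of "cis t" "cis 0"] that f0 by (simp add: f_def)
  have "n \<noteq> 0"
  proof
    assume "n = 0"
    then have "cis pi = 1"
      by (intro f_eq_1) (simp add: f_cis)
    then show False by simp
  qed
  \<comment> \<open>The point with angle \<open>2 * pi / n\<close> lies in the kernel of the power
    map, so by injectivity it is 1 and \<open>n\<close> divides 1.\<close>
  then have "f (2 * pi * (1 / of_int n)) = 1"
    by (simp add: f_cis)
  then have "1 / real_of_int n \<in> \<int>"
    using f_eq_1 cis_2pi_eq_1_iff by blast
  then obtain m where "1 / real_of_int n = of_int m"
    using Ints_cases by metis
  then have "real_of_int (n * m) = 1"
    using \<open>n \<noteq> 0\<close> by (simp add: field_simps)
  then have "n * m = 1"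
    by linarith
  then have n: "n = 1 \<or> n = -1"
    by (simp add: zmult_eq_1_iff) auto
  have "z = cis (Arg z)"
    using z cis_Arg[of z] by (cases "z = 0") (auto simp: sgn_div_norm)
  moreover have "f (Arg z) = cis (Arg z) \<or> f (Arg z) = inverse (cis (Arg z))"
    using n by (auto simp: f_cis)
  ultimately show ?thesis
    unfolding f_def by metis
qed

text \<open>Transported along \<open>h\<close>, automorphisms become automorphisms of the circle, so
  every orbit has at most two points and is closed. A dense one would make the circle finite, but it
  is connected and has more than one point.\<close>

lemma circle_no_dense_orbit:
  assumes G: "group G" and iso: "topologically_isomorphic G X circle_group circle_topology"
    and X: "topspace X = carrier G" "Hausdorff_space X"
  shows "\<not> has_dense_orbit X (continuous_Aut G X) (\<lambda>\<alpha>. \<alpha>)"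
proof
  assume "has_dense_orbit X (continuous_Aut G X) (\<lambda>\<alpha>. \<alpha>)"
  then obtain x where x: "x \<in> carrier G"
      "X closure_of (orbit (continuous_Aut G X) (\<lambda>\<alpha>. \<alpha>) x) = carrier G"
    using X(1) by (auto simp: has_dense_orbit_def)
  obtain h where h: "h \<in> iso G circle_group" "homeomorphic_map X circle_topology h"
    using iso unfolding topologically_isomorphic_def by blast
  obtain h' where h': "homeomorphic_maps X circle_topology h h'"
    using h(2) homeomorphic_map_maps by blast
  have cont: "continuous_map X circle_topology h" "continuous_map circle_topology X h'"
    and h'h: "\<And>g. g \<in> carrier G \<Longrightarrow> h' (h g) = g" and hh': "\<And>z. z \<in> sphere 0 1 \<Longrightarrow> h (h' z) = z"
    using h' X(1) by (auto simp: homeomorphic_maps_def)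
  have h_mult: "h (a \<otimes>\<^bsub>G\<^esub> b) = h a * h b" if "a \<in> carrier G" "b \<in> carrier G" for a b
    using h(1) that by (simp add: iso_def hom_def circle_group_def)
  have h_im: "h a \<in> sphere 0 1" if "a \<in> carrier G" for a
    using h(1) that by (auto simp: iso_def hom_def circle_group_def)
  have h'_im: "h' z \<in> carrier G" if "z \<in> sphere 0 1" for z
    using cont(2) that X(1) by (auto simp: continuous_map_def)
  have "\<alpha> x \<in> {x, h' (inverse (h x))}" if \<alpha>: "\<alpha> \<in> carrier (continuous_Aut G X)" for \<alpha>
  proof -
    have \<alpha>_hom: "\<alpha> (a \<otimes>\<^bsub>G\<^esub> b) = \<alpha> a \<otimes>\<^bsub>G\<^esub> \<alpha> b" "\<alpha> a \<in> carrier G" if "a \<in> carrier G" "b \<in> carrier G" for a b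
      using \<alpha> that by (auto simp: continuous_Aut_def auto_def hom_def)
    have \<alpha>_inj: "inj_on \<alpha> (carrier G)" and \<alpha>_cont: "continuous_map X X \<alpha>"
      using \<alpha> by (auto simp: continuous_Aut_def auto_def Bij_def bij_betw_def)
    define \<beta> where "\<beta> = (\<lambda>z. h (\<alpha> (h' z)))"
    have "\<beta> (h x) = h x \<or> \<beta> (h x) = inverse (h x)"
    proof (rule circle_automorphism)
      have "continuous_map circle_topology circle_topology (h \<circ> \<alpha> \<circ> h')"
        using cont \<alpha>_cont by (intro continuous_map_compose)
      then show "continuous_on (sphere 0 1) \<beta>"
        by (simp add: \<beta>_def o_def)
      show "\<beta> z \<in> sphere 0 1" if "z \<in> sphere 0 1" for z
        unfolding \<beta>_def by (intro h_im \<alpha>_hom(2)[of _ x] h'_im that x)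
      show "\<beta> (z * w) = \<beta> z * \<beta> w" if zw: "z \<in> sphere 0 1" "w \<in> sphere 0 1" for z w
      proof -
        have c: "h' z \<in> carrier G" "h' w \<in> carrier G"
          using zw h'_im by auto
        have "z * w \<in> sphere 0 1"
          using zw by (simp add: norm_mult)
        have "h (h' z \<otimes>\<^bsub>G\<^esub> h' w) = z * w"
          using h_mult c hh' zw by simp
        moreover have "h' z \<otimes>\<^bsub>G\<^esub> h' w \<in> carrier G"
          using c G by (simp add: group.is_monoid monoid.m_closed)
        ultimately have "h' (z * w) = h' z \<otimes>\<^bsub>G\<^esub> h' w"
          using h'h by metis
        then show ?thesis
          using c \<alpha>_hom h_mult by (simp add: \<beta>_def)
      qed
      show "inj_on \<beta> (sphere 0 1)"
      proof (rule inj_onI)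
        fix z w assume zw: "z \<in> sphere 0 1" "w \<in> sphere 0 1" "\<beta> z = \<beta> w"
        have c: "h' z \<in> carrier G" "h' w \<in> carrier G"
          using zw h'_im by auto
        then have "\<alpha> (h' z) = \<alpha> (h' w)"
          using zw(3) h'h \<alpha>_hom(2) unfolding \<beta>_def by metis
        then have "h' z = h' w"
          using \<alpha>_inj c by (auto dest: inj_onD)
        then show "z = w"
          using hh' zw by metis
      qed
      show "h x \<in> sphere 0 1"
        by (rule h_im[OF x(1)])
    qed
    then have "h (\<alpha> x) = h x \<or> h (\<alpha> x) = inverse (h x)"
      using h'h[OF x(1)] by (simp add: \<beta>_def)
    then show ?thesis
      using h'h[OF x(1)] h'h[OF \<alpha>_hom(2)[OF x(1) x(1)]] by auto
  qed
  then have orb: "orbit (continuous_Aut G X) (\<lambda>\<alpha>. \<alpha>) x \<subseteq> {x, h' (inverse (h x))}"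
    by (auto simp: orbit_def)
  have "inverse (h x) \<in> sphere 0 1"
    using h_im[OF x(1)] by (simp add: norm_inverse)
  then have "closedin X {x, h' (inverse (h x))}"
    using closedin_Hausdorff_finite[OF X(2)] x(1) h'_im X(1) by simp
  then have "carrier G \<subseteq> {x, h' (inverse (h x))}"
    using orb x(2) closure_of_minimal by metis
  then have "finite (carrier G)"
    using finite_subset by blast
  moreover have "sphere 0 1 \<subseteq> h ` carrier G"
    using hh' h'_im by (metis imageI subsetI)
  ultimately have "finite (sphere (0::complex) 1)"
    by (meson finite_surj)
  moreover have "connected (sphere (0::complex) 1)"
    by (rule connected_sphere) simp
  ultimately have "sphere (0::complex) 1 = {} \<or> (\<exists>a. sphere (0::complex) 1 = {a})"
    by (simp add: connected_finite_iff_sing del: sphere_eq_empty)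
  then obtain a where "sphere (0::complex) 1 \<subseteq> {a}"
    by blast
  moreover have "1 \<in> sphere (0::complex) 1" "-1 \<in> sphere (0::complex) 1"
    by simp_all
  ultimately have "(1::complex) = -1"
    by blast
  then show False
    by simp
qed

section \<open>Connected abelian Lie groups\<close>

lemma (in additive_chart) vector_cover:
  assumes "connected_space X"
  shows "vector_cover G X V E d"
proof (unfold_locales)
  show "E (v + w) = E v \<otimes> E w" if "v \<in> V" "w \<in> V" for v w
    using that by (rule E_add)
  show "v = 0" if "v \<in> V" "norm v < d" "E v = \<one>" for v
    using that by (intro E_kernel_discrete) auto
qed (use subspace_V E_continuous E_open E_surj[OF assms] d_bounds in auto)

text \<open>In a chart around the identity, with \<open>p = \<phi> \<one>\<close>, multiplication
  becomes a map \<open>F\<close> with \<open>F (x, p) = x\<close> and \<open>F (p, y) = y\<close>.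
  Its mixed second difference is \<open>F (x, y) - x - y + p\<close>, and recentring the chart at 0
  turns the bound for it into \<open>mult_bound\<close>.\<close>

lemma (in lie_group) abelian_additive_chart:
  assumes "comm_group G"
  obtains U \<psi> C r where "additive_chart G X V U \<psi> C r"
proof -
  interpret comm_group G by fact
  have cont_mult: "continuous_map (prod_topology X X) X (\<lambda>(x, y). x \<otimes> y)"
    and cont_inv: "continuous_map X X (\<lambda>x. inv x)"
    using smooth_mult smooth_inv by (simp_all add: smooth_map_def)
  have "\<one> \<in> (\<Union>c\<in>A. fst c)"
    using charts_cover topspace_eq_carrier by simp
  then obtain U \<phi> where UA: "(U, \<phi>) \<in> A" and one: "\<one> \<in> U"
    by auto
  have chart: "is_chart X V (U, \<phi>)"
    using charts[OF UA] .
  then have U: "openin X U" and \<phi>U: "openin (top_of_set V) (\<phi> ` U)"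
    and hom: "homeomorphic_map (subtopology X U) (top_of_set (\<phi> ` U)) \<phi>"
    by (auto simp: is_chart_def)
  have U_carrier: "U \<subseteq> carrier G"
    using openin_subset[OF U] topspace_eq_carrier by simp
  then have topU: "topspace (subtopology X U) = U"
    by (auto simp: topspace_eq_carrier)
  have inj: "inj_on \<phi> U"
    using homeomorphic_imp_injective_map[OF hom] topU by simp
  define p where "p = \<phi> \<one>"
  have \<phi>V: "\<phi> x \<in> V" if "x \<in> U" for x
    using \<phi>U openin_imp_subset that by blast
  have pV: "p \<in> V"
    using \<phi>V one by (simp add: p_def)
  \<comment> \<open>The pairs in the chart domain whose product stays in it; their coordinates form
    the domain of \<open>F\<close>.\<close>
  define P where "P = {z \<in> U \<times> U. (case z of (x, y) \<Rightarrow> x \<otimes> y) \<in> U}"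
  \<comment> \<open>The coordinate expression in the form in which \<open>smooth_map\<close>
    produces it for \<open>prod_atlas\<close>.\<close>
  define F where "F = (\<lambda>q. \<phi> (case inv_into (U \<times> U) (map_prod \<phi> \<phi>) q of (x, y) \<Rightarrow> x \<otimes> y))"
  have injP: "inj_on (map_prod \<phi> \<phi>) (U \<times> U)"
    by (intro map_prod_inj_on inj)
  have F: "F (\<phi> x, \<phi> y) = \<phi> (x \<otimes> y)" if "x \<in> U" "y \<in> U" for x y
    using inv_into_f_f[OF injP, of "(x, y)"] that by (simp add: F_def)
  have "(U \<times> U, map_prod \<phi> \<phi>) \<in> prod_atlas A A"
    using UA by (auto simp: prod_atlas_def)
  then have "smooth_on (V \<times> V) (map_prod \<phi> \<phi> ` P) F"
    using smooth_mult UA unfolding smooth_map_def P_def F_def by fastforce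
  then have F_C2: "C_k 2 (V \<times> V) (map_prod \<phi> \<phi> ` P) F"
    by (simp add: smooth_on_def)
  have open_P: "openin (prod_topology X X) P"
  proof -
    have "P = (U \<times> U) \<inter> {z \<in> topspace (prod_topology X X). (case z of (x, y) \<Rightarrow> x \<otimes> y) \<in> U}"
      using U_carrier by (auto simp: P_def topspace_eq_carrier)
    moreover have "openin (prod_topology X X) {z \<in> topspace (prod_topology X X). (case z of (x, y) \<Rightarrow> x \<otimes> y) \<in> U}"
      using openin_continuous_map_preimage[OF cont_mult U] .
    moreover have "openin (prod_topology X X) (U \<times> U)"
      using U by (simp add: openin_prod_Times_iff)
    ultimately show ?thesis
      by (simp add: openin_Int)
  qed
  have open_W: "openin (top_of_set (V \<times> V)) (map_prod \<phi> \<phi> ` P)"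
    unfolding openin_subopen[of _ "map_prod \<phi> \<phi> ` P"]
  proof (intro ballI)
    fix q assume "q \<in> map_prod \<phi> \<phi> ` P"
    then obtain x y where xy: "(x, y) \<in> P" "q = (\<phi> x, \<phi> y)"
      by auto
    then obtain S T where ST: "openin X S" "openin X T" "x \<in> S" "y \<in> T" "S \<times> T \<subseteq> P"
      using open_P unfolding openin_prod_topology_alt by metis
    have "S \<subseteq> U" "T \<subseteq> U"
      using ST unfolding P_def by auto
    then have "openin (top_of_set (V \<times> V)) (\<phi> ` S \<times> \<phi> ` T)"
      using ST by (intro openin_Times is_chart_open_image[OF chart])
    moreover have "\<phi> ` S \<times> \<phi> ` T \<subseteq> map_prod \<phi> \<phi> ` P"
      using ST(5) by auto
    ultimately show "\<exists>T. openin (top_of_set (V \<times> V)) T \<and> q \<in> T \<and> T \<subseteq> map_prod \<phi> \<phi> ` P"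
      using ST xy by blast
  qed
  have "(\<one>, \<one>) \<in> P"
    using one by (simp add: P_def)
  then have pp: "(p, p) \<in> map_prod \<phi> \<phi> ` P"
    by (force simp: p_def)
  obtain C r1 where C: "C > 0" "r1 > 0"
    and bound: "\<And>x y. x \<in> V \<Longrightarrow> y \<in> V \<Longrightarrow> norm (x - p) \<le> r1 \<Longrightarrow> norm (y - p) \<le> r1 \<Longrightarrow>
      (x, y) \<in> map_prod \<phi> \<phi> ` P \<and> norm (F (x, y) - F (x, p) - F (p, y) + F (p, p)) \<le> C * norm (x - p) * norm (y - p)"
    using second_difference_bound[OF subspace_model F_C2 open_W pp] by metis
  define \<psi> where "\<psi> = (\<lambda>x. \<phi> x - p)"
  have tr: "homeomorphic_map (top_of_set (\<phi> ` U)) (top_of_set (\<psi> ` U)) (\<lambda>x. x - p)"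
  proof -
    have "homeomorphic_maps (top_of_set (\<phi> ` U)) (top_of_set (\<psi> ` U)) (\<lambda>x. x - p) (\<lambda>x. x + p)"
      by (auto simp: homeomorphic_maps_def \<psi>_def intro!: continuous_intros)
    then show ?thesis
      by (rule homeomorphic_maps_imp_map)
  qed
  have homeo: "homeomorphic_map (subtopology X U) (top_of_set (\<psi> ` U)) \<psi>"
    using homeomorphic_map_compose[OF hom tr] by (simp add: \<psi>_def o_def)
  have \<psi>U: "openin (top_of_set V) (\<psi> ` U)"
    unfolding openin_contains_ball
  proof (intro conjI ballI)
    show "\<psi> ` U \<subseteq> V"
      using \<phi>V pV subspace_diff[OF subspace_model] by (auto simp: \<psi>_def)
    fix w assume "w \<in> \<psi> ` U"
    then have "w + p \<in> \<phi> ` U"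
      by (auto simp: \<psi>_def)
    then obtain e where e: "e > 0" "ball (w + p) e \<inter> V \<subseteq> \<phi> ` U"
      using \<phi>U unfolding openin_contains_ball by blast
    have "ball w e \<inter> V \<subseteq> \<psi> ` U"
    proof
      fix u assume "u \<in> ball w e \<inter> V"
      then have "u + p \<in> ball (w + p) e \<inter> V"
        using pV subspace_add[OF subspace_model] by (simp add: dist_norm)
      then have "u + p \<in> \<phi> ` U"
        using e(2) by blast
      then show "u \<in> \<psi> ` U"
        by (force simp: \<psi>_def algebra_simps)
    qed
    then show "\<exists>e>0. ball w e \<inter> V \<subseteq> \<psi> ` U"
      using e(1) by blast
  qed
  have "0 \<in> \<psi> ` U"
    using one by (force simp: \<psi>_def p_def)
  then obtain r2 where r2: "r2 > 0" "ball 0 r2 \<inter> V \<subseteq> \<psi> ` U"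
    using \<psi>U unfolding openin_contains_ball by blast
  \<comment> \<open>Halving \<open>r2\<close> fits the closed ball of \<open>additive_chart\<close>
    into the open ball found here.\<close>
  define r where "r = min r1 (r2 / 2)"
  have r: "r > 0" "r \<le> r1" "r < r2"
    using C r2 by (auto simp: r_def)
  have "additive_chart G X V U \<psi> C r"
  proof unfold_locales
    show "cball 0 r \<inter> V \<subseteq> \<psi> ` U"
      using r2(2) r(3) by (auto simp: subset_iff)
    fix x y assume xy: "x \<in> U" "y \<in> U" "norm (\<psi> x) \<le> r" "norm (\<psi> y) \<le> r"
    then have b: "(\<phi> x, \<phi> y) \<in> map_prod \<phi> \<phi> ` P"
      "norm (F (\<phi> x, \<phi> y) - F (\<phi> x, p) - F (p, \<phi> y) + F (p, p)) \<le> C * norm (\<phi> x - p) * norm (\<phi> y - p)"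
      using bound[OF \<phi>V[OF xy(1)] \<phi>V[OF xy(2)]] r(2) by (auto simp: \<psi>_def)
    \<comment> \<open>Membership in the image gives only some pair in \<open>P\<close> with the same
      coordinates; injectivity of \<open>\<phi>\<close> on \<open>U\<close> identifies it with
      \<open>(x, y)\<close>.\<close>
    from b(1) obtain x' y' where "(x', y') \<in> P" "\<phi> x = \<phi> x'" "\<phi> y = \<phi> y'"
      by auto
    then have xyU: "x \<otimes> y \<in> U"
      using inj_onD[OF inj, of x x'] inj_onD[OF inj, of y y'] xy by (auto simp: P_def)
    have Fp: "F (\<phi> x, p) = \<phi> x" "F (p, \<phi> y) = \<phi> y" "F (p, p) = p"
      unfolding p_def using F[of x \<one>] F[of \<one> y] F[of \<one> \<one>] xy one U_carrier by (auto simp: subset_iff)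
    have eq: "\<psi> (x \<otimes> y) - \<psi> x - \<psi> y = \<phi> (x \<otimes> y) - \<phi> x - \<phi> y + p"
      by (simp add: \<psi>_def)
    show "x \<otimes> y \<in> U \<and> norm (\<psi> (x \<otimes> y) - \<psi> x - \<psi> y) \<le> C * norm (\<psi> x) * norm (\<psi> y)"
      unfolding eq using xyU Fp b(2) F[OF xy(1,2)] by (simp add: \<psi>_def)
  qed (use topspace_eq_carrier Hausdorff cont_mult cont_inv subspace_model U one homeo \<psi>U C r in
      \<open>auto simp: \<psi>_def p_def\<close>)
  then show thesis
    by (rule that)
qed

theorem proposition5p1:
  fixes G :: "('a, 'b) monoid_scheme"
    and X :: "'a topology"
    and V :: "'e::euclidean_space set"
    and A :: "('a, 'e) chart set"
  assumes "lie_group G X V A"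
    and "comm_group G"
    and "connected_space X"
  shows "has_dense_orbit X (continuous_Aut G X) (\<lambda>\<alpha>. \<alpha>) \<longleftrightarrow>
         \<not> topologically_isomorphic G X circle_group circle_topology"
proof -
  interpret lie_group G X V A by fact
  obtain U \<psi> C r where "additive_chart G X V U \<psi> C r"
    using abelian_additive_chart[OF assms(2)] .
  then interpret additive_chart G X V U \<psi> C r .
  interpret vector_cover G X V E d
    by (rule vector_cover[OF assms(3)])
  show ?thesis
  proof
    show "\<not> topologically_isomorphic G X circle_group circle_topology"
      if "has_dense_orbit X (continuous_Aut G X) (\<lambda>\<alpha>. \<alpha>)"
      using circle_no_dense_orbit[OF is_group _ topspace_eq_carrier Hausdorff] that by blast
    show "has_dense_orbit X (continuous_Aut G X) (\<lambda>\<alpha>. \<alpha>)"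
      if "\<not> topologically_isomorphic G X circle_group circle_topology"
    proof (cases "V \<subseteq> span \<Gamma>")
      case True
      then have "dim V \<noteq> 1"
        using circle_if_rank_one that by blast
      then consider "dim V = 0" | "dim V \<ge> 2"
        by linarith
      then show ?thesis
      proof cases
        case 1
        \<comment> \<open>Here \<open>V = {0}\<close>: the group is trivial, and the orbit of its
          identity is everything.\<close>
        then have "V \<subseteq> closure {0}"
          using closure_subset by (auto simp: dim_eq_0)
        moreover have "0 \<in> V"
          using subspace_0[OF subspace_model] .
        ultimately show ?thesis
          using has_dense_orbitI[of 0 "{0}"] orbit_closure_refl by blast
      next
        case 2
        then show ?thesis
          by (rule dense_orbit_if_spanning[OF True])
      qed
    next
      case False
      then show ?thesis
        by (rule dense_orbit_if_not_spanning)
    qed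
  qed
qed

end
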